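(* Let $d$ be a positive square-free integer, let $\mathcal{O}_d$ denote the ring of integers of $\mathbb{Q}(\sqrt{-d})$, and let $t\in \mathcal{O}_d$ with $|t|\geq 100$. Then every solution $(x,y)\in\mathcal{O}_d^2$ of the inequality \[ |F_t(x,y)| = |x^4 - t x^3 y - 6 x^2 y^2 + t x y^3 + y^4| \leq 1 \] is trivial, i.e.\ of the shape $(0,0)$, $(\xi,0)$ or $(0,\xi)$, where $\xi$ is a root of unity in $\mathcal{O}_d$.
   Context: $|\cdot|$ denotes the usual complex absolute value. *)

theory Defs
  imports "HOL-Computational_Algebra.Computational_Algebra"
begin

text \<open>
  The number field \<open>\<rat>(\<surd>-d)\<close>, embedded in the complex numbers by means of the square root
  \<open>csqrt (- d) = \<i> * sqrt d\<close> (the other choice of square root gives the same set). The lemma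
  \<open>imag_quad_field_eq_generated\<close> below identifies it with the subfield generated by \<open>\<surd>-d\<close>.
\<close>

definition imag_quad_field :: "nat \<Rightarrow> complex set" where
  "imag_quad_field d = {of_rat a + of_rat b * csqrt (- of_nat d) | a b. True}"

definition imag_quad_integers :: "nat \<Rightarrow> complex set" where
  "imag_quad_integers d = {z \<in> imag_quad_field d. algebraic_int z}"

definition root_of_unity :: "complex \<Rightarrow> bool" where
  "root_of_unity z \<longleftrightarrow> (\<exists>n::nat. n > 0 \<and> z ^ n = 1)"

definition quartic_form :: "complex \<Rightarrow> complex \<Rightarrow> complex \<Rightarrow> complex" where
  "quartic_form t x y = x ^ 4 - t * x ^ 3 * y - 6 * x\<^sup>2 * y\<^sup>2 + t * x * y ^ 3 + y ^ 4"

definition complex_subfield :: "complex set \<Rightarrow> bool" where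
  "complex_subfield K \<longleftrightarrow> 1 \<in> K \<and> (\<forall>x\<in>K. \<forall>y\<in>K. x - y \<in> K \<and> x * y \<in> K) \<and>
     (\<forall>x\<in>K. inverse x \<in> K)"

lemma complex_subfield_imag_quad_field: "complex_subfield (imag_quad_field d)"
proof -
  define s where "s = csqrt (- of_nat d)"
  have s2: "s * s = - of_nat d"
    unfolding s_def by (metis power2_csqrt power2_eq_square)
  have K: "imag_quad_field d = {of_rat a + of_rat b * s | a b. True}"
    by (simp add: imag_quad_field_def s_def)
  have mem: "of_rat a + of_rat b * s \<in> imag_quad_field d" for a b
    unfolding K by blast
  have one: "1 \<in> imag_quad_field d"
    using mem[of 1 0] by simp
  have diff: "x - y \<in> imag_quad_field d"
    if xy: "x \<in> imag_quad_field d" "y \<in> imag_quad_field d" for x y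
  proof -
    obtain a b where x: "x = of_rat a + of_rat b * s"
      using xy(1) unfolding K by blast
    obtain a' b' where y: "y = of_rat a' + of_rat b' * s"
      using xy(2) unfolding K by blast
    have "x - y = of_rat (a - a') + of_rat (b - b') * s"
      by (simp add: x y of_rat_diff algebra_simps)
    then show ?thesis
      using mem by metis
  qed
  have mult: "x * y \<in> imag_quad_field d"
    if xy: "x \<in> imag_quad_field d" "y \<in> imag_quad_field d" for x y
  proof -
    obtain a b where x: "x = of_rat a + of_rat b * s"
      using xy(1) unfolding K by blast
    obtain a' b' where y: "y = of_rat a' + of_rat b' * s"
      using xy(2) unfolding K by blast
    have "x * y = of_rat a * of_rat a' + of_rat b * of_rat b' * (s * s)
        + (of_rat a * of_rat b' + of_rat a' * of_rat b) * s"
      by (simp add: x y algebra_simps)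
    also have "\<dots> = of_rat (a * a' - b * b' * of_nat d) + of_rat (a * b' + a' * b) * s"
      unfolding s2 by (simp add: of_rat_diff of_rat_add of_rat_mult)
    finally show ?thesis
      using mem by metis
  qed
  have inv: "inverse x \<in> imag_quad_field d" if xK: "x \<in> imag_quad_field d" for x
  proof (cases "x = 0")
    case True
    then show ?thesis using xK by simp
  next
    case False
    obtain a b where x: "x = of_rat a + of_rat b * s"
      using xK unfolding K by blast
    define N where "N = a * a + b * b * of_nat d"
    have N: "x * (of_rat a - of_rat b * s) = of_rat N"
    proof -
      have "x * (of_rat a - of_rat b * s) = of_rat a * of_rat a - of_rat b * of_rat b * (s * s)"
        by (simp add: x algebra_simps)
      then show ?thesis
        unfolding s2 by (simp add: N_def of_rat_add of_rat_mult)
    qed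
    have "N \<noteq> 0"
    proof
      assume "N = 0"
      moreover have "a * a \<ge> 0" "b * b * of_nat d \<ge> 0" by simp_all
      ultimately have "a * a = 0" "b * b * of_nat d = 0"
        unfolding N_def by (simp_all add: add_nonneg_eq_0_iff)
      then have "a = 0" "b = 0 \<or> d = 0" by auto
      then have "x = 0" by (auto simp: x s_def)
      with False show False by simp
    qed
    then have "inverse x = (of_rat a - of_rat b * s) / of_rat N"
      using N False by (simp add: field_simps)
    also have "\<dots> = of_rat (a / N) + of_rat (- b / N) * s"
      by (simp add: of_rat_divide of_rat_minus diff_divide_distrib)
    finally show ?thesis
      using mem by metis
  qed
  show ?thesis
    unfolding complex_subfield_def using one diff mult inv by blast
qed

lemma imag_quad_field_eq_generated:
  "imag_quad_field d = \<Inter> {K. complex_subfield K \<and> csqrt (- of_nat d) \<in> K}"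
proof (intro equalityI subsetI)
  fix z assume "z \<in> imag_quad_field d"
  then obtain a b where z: "z = of_rat a + of_rat b * csqrt (- of_nat d)"
    unfolding imag_quad_field_def by blast
  show "z \<in> \<Inter> {K. complex_subfield K \<and> csqrt (- of_nat d) \<in> K}"
  proof (intro InterI, elim CollectE conjE)
    fix K assume K: "complex_subfield K" and s: "csqrt (- of_nat d) \<in> K"
    have one: "1 \<in> K" and diff: "\<And>x y. x \<in> K \<Longrightarrow> y \<in> K \<Longrightarrow> x - y \<in> K"
      and mult: "\<And>x y. x \<in> K \<Longrightarrow> y \<in> K \<Longrightarrow> x * y \<in> K"
      and inv: "\<And>x. x \<in> K \<Longrightarrow> inverse x \<in> K"
      using K unfolding complex_subfield_def by blast+
    have zero: "0 \<in> K" using diff[OF one one] by simp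
    have add: "x + y \<in> K" if "x \<in> K" "y \<in> K" for x y
      using diff[OF that(1) diff[OF zero that(2)]] by simp
    have nat: "of_nat n \<in> K" for n
      by (induction n) (auto simp: zero one add)
    have int: "of_int k \<in> K" for k
    proof (cases k)
      case (nonneg n)
      then show ?thesis using nat[of n] by simp
    next
      case (neg n)
      then show ?thesis using diff[OF zero nat[of "Suc n"]] by simp
    qed
    have rat: "of_rat q \<in> K" for q
    proof (cases q)
      case (Fract m n)
      then show ?thesis
        using mult[OF int[of m] inv[OF int[of n]]] by (simp add: of_rat_rat divide_inverse)
    qed
    show "z \<in> K"
      unfolding z by (intro add mult rat s)
  qed
next
  fix z assume z: "z \<in> \<Inter> {K. complex_subfield K \<and> csqrt (- of_nat d) \<in> K}"
  have "csqrt (- of_nat d) = of_rat 0 + of_rat 1 * csqrt (- of_nat d)"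
    by simp
  then have "csqrt (- of_nat d) \<in> imag_quad_field d"
    unfolding imag_quad_field_def by blast
  with z complex_subfield_imag_quad_field show "z \<in> imag_quad_field d"
    by blast
qed

end

theory Submission
  imports Defs "HOL-Analysis.Generalised_Binomial_Theorem"
begin

text \<open>
  With \<open>U = x + \<i>y\<close>, \<open>V = x - \<i>y\<close>, \<open>u = \<i>t + 4\<close>, \<open>w = \<i>t - 4\<close> the form is diagonal: \<open>8 F = u U^4 - w V^4\<close>.
  Hence a solution makes \<open>U / V\<close> extremely close to a fourth root of \<open>w / u\<close>, and the rotations
  \<open>(x, y) \<mapsto> (y, -x)\<close> and \<open>(x, y) \<mapsto> (x + y, y - x)\<close>, which preserve \<open>F\<close> up to a factor \<open>-4\<close>, allow to take
  for it the principal root \<open>\<omega>\<close>, which is close to 1. The diagonal Pade approximants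
  \<open>S\<^sub>n / T\<^sub>n\<close> of \<open>\<omega> = (1 - 8/u)^(1/4)\<close> give linear forms \<open>T\<^sub>n U - S\<^sub>n V\<close>. Conjugation \<open>\<i> \<mapsto> -\<i>\<close>
  (with \<open>t\<close>, \<open>x\<close>, \<open>y\<close> fixed) interchanges the two terms up to sign, so each form is 0 or at least twice the
  common factor of the coefficients of the approximants in absolute value, and no two consecutive forms vanish.
  For \<open>y \<noteq> 0\<close> this yields by induction on \<open>n\<close> ever larger lower bounds for \<open>V\<close>, a contradiction.

  The approximants with only the obvious denominators cleared would require roughly \<open>|t| > 128\<close>. To reach
  \<open>|t| \<ge> 100\<close>, a common factor of their coefficients of size at least \<open>2^(n/3)\<close> is divided out. It is
  an explicit quotient of factorials, so no estimates for prime numbers are needed.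
\<close>

subsection \<open>Integers of imaginary quadratic fields\<close>

text \<open>If \<open>cmod e < 1\<close>, then \<open>of_nat D * e ^ k\<close> tends to 0, yet its
  squared modulus \<open>a\<^sup>2 + b\<^sup>2 * d\<close> is always a positive integer.\<close>

lemma cmod_ge_1_of_bounded_denominators:
  fixes e :: complex and D :: nat
  assumes D: "D > 0" and e: "e \<noteq> 0"
    and pow: "\<And>k. \<exists>a b::int. of_nat D * e ^ k = of_int a + of_int b * csqrt (- of_nat d)"
  shows "cmod e \<ge> 1"
proof (rule ccontr)
  assume "\<not> cmod e \<ge> 1"
  then have lt: "cmod e < 1" by simp
  have "(\<lambda>k. cmod e ^ k) \<longlonglongrightarrow> 0"
    using lt by (intro LIMSEQ_realpow_zero) auto
  then have "eventually (\<lambda>k. cmod e ^ k < 1 / real D) sequentially"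
    using D by (intro order_tendstoD) auto
  then obtain k where k: "cmod e ^ k < 1 / real D"
    by (auto simp: eventually_sequentially)
  obtain a b :: int where ab: "of_nat D * e ^ k = of_int a + of_int b * csqrt (- of_nat d)"
    using pow by blast
  have cs: "csqrt (- of_nat d) = \<i> * of_real (sqrt (real d))"
    by (simp add: complex_eq_iff csqrt.simps)
  have Re: "Re (of_nat D * e ^ k) = real_of_int a"
    and Im: "Im (of_nat D * e ^ k) = real_of_int b * sqrt (real d)"
    unfolding ab cs by simp_all
  have "(cmod (of_nat D * e ^ k))\<^sup>2 = real_of_int (a\<^sup>2 + b\<^sup>2 * int d)"
    unfolding cmod_power2 Re Im by (simp add: power_mult_distrib)
  moreover have "cmod (of_nat D * e ^ k) < 1"
    using k D by (simp add: norm_mult norm_power field_simps)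
  then have "(cmod (of_nat D * e ^ k))\<^sup>2 < 1"
    by (simp add: abs_square_less_1)
  moreover have "(cmod (of_nat D * e ^ k))\<^sup>2 > 0"
    using e D by simp
  ultimately have "0 < a\<^sup>2 + b\<^sup>2 * int d" "a\<^sup>2 + b\<^sup>2 * int d < 1"
    by linarith+
  then show False by linarith
qed

text \<open>A monic integer equation of degree \<open>n\<close> reduces every power of
  \<open>z\<close> to integer combinations of lower ones, so a common denominator of the powers
  below \<open>n\<close> serves for all.\<close>

lemma powers_bounded_denominator:
  assumes "z \<in> imag_quad_integers d"
  obtains D :: nat where "D > 0"
    "\<And>k. \<exists>a b::int. of_nat D * z ^ k = of_int a + of_int b * csqrt (- of_nat d)"
proof -
  define s where "s = csqrt (- of_nat d)"
  define L where "L = {of_int a + of_int b * s | a b. True}"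
  have zK: "z \<in> imag_quad_field d" and zi: "algebraic_int z"
    using assms by (auto simp: imag_quad_integers_def)
  have L_add: "u + v \<in> L" if "u \<in> L" "v \<in> L" for u v
  proof -
    from that obtain a b a' b' where "u = of_int a + of_int b * s" "v = of_int a' + of_int b' * s"
      unfolding L_def by blast
    then have "u + v = of_int (a + a') + of_int (b + b') * s"
      by (simp add: algebra_simps)
    then show ?thesis unfolding L_def by blast
  qed
  have L_scale: "of_int m * v \<in> L" if "v \<in> L" for m v
  proof -
    from that obtain a b where "v = of_int a + of_int b * s"
      unfolding L_def by blast
    then have "of_int m * v = of_int (m * a) + of_int (m * b) * s"
      by (simp add: algebra_simps)
    then show ?thesis unfolding L_def by blast
  qed
  have L_sum: "(\<Sum>i\<in>I. g i) \<in> L" if "\<And>i. i \<in> I \<Longrightarrow> g i \<in> L" for I :: "nat set" and g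
    using that
  proof (induction I rule: infinite_finite_induct)
    case empty
    have "(0::complex) = of_int 0 + of_int 0 * s" by simp
    then show ?case unfolding L_def by (metis (mono_tags, lifting) mem_Collect_eq sum.empty)
  next
    case (infinite A)
    have "(0::complex) = of_int 0 + of_int 0 * s" by simp
    then show ?case using infinite unfolding L_def by (metis (mono_tags, lifting) mem_Collect_eq sum.infinite)
  qed (auto intro: L_add)
  obtain p :: "int poly" where p: "poly (map_poly of_int p) z = 0" "lead_coeff p = 1"
    using zi by (auto simp: algebraic_int_altdef_ipoly)
  define n where "n = degree p"
  have powK: "z ^ k \<in> imag_quad_field d" for k
    using complex_subfield_imag_quad_field[of d] zK
    by (induction k) (auto simp: complex_subfield_def)
  have "\<exists>D::nat. D > 0 \<and> of_nat D * z ^ k \<in> L" for k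
  proof -
    obtain A B where AB: "z ^ k = of_rat A + of_rat B * s"
      using powK[of k] unfolding imag_quad_field_def s_def by blast
    obtain a b where A: "A = of_int a / of_int b" "b > 0"
      by (cases A) (auto simp: Fract_of_int_quotient)
    obtain a' b' where B: "B = of_int a' / of_int b'" "b' > 0"
      by (cases B) (auto simp: Fract_of_int_quotient)
    have "of_nat (nat (b * b')) * z ^ k = of_int (a * b') + of_int (a' * b) * s"
      using A(2) B(2) unfolding AB A(1) B(1) by (simp add: of_rat_divide field_simps)
    then have "of_nat (nat (b * b')) * z ^ k \<in> L"
      unfolding L_def by blast
    then show ?thesis
      using A(2) B(2) by (intro exI[of _ "nat (b * b')"]) auto
  qed
  then obtain E where E: "\<And>k. E k > (0::nat)" "\<And>k. of_nat (E k) * z ^ k \<in> L"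
    by metis
  define D where "D = (\<Prod>k<n. E k)"
  have D0: "D > 0" unfolding D_def using E by (simp add: prod_pos)
  have "of_nat D * z ^ k \<in> L" for k
  proof (induction k rule: less_induct)
    case (less k)
    show ?case
    proof (cases "k < n")
      case True
      then have "D = E k * (\<Prod>j\<in>{..<n}-{k}. E j)"
        unfolding D_def by (subst prod.remove[of _ k]) auto
      then have "of_nat D * z ^ k = of_int (int (\<Prod>j\<in>{..<n}-{k}. E j)) * (of_nat (E k) * z ^ k)"
        by (simp only: of_nat_mult of_int_of_nat_eq mult_ac)
      then show ?thesis using L_scale[OF E(2)] by metis
    next
      case False
      have "0 = (\<Sum>i\<le>n. of_int (coeff p i) * z ^ i)"
        using p(1) by (simp add: poly_altdef n_def degree_map_poly coeff_map_poly)
      also have "\<dots> = z ^ n + (\<Sum>i<n. of_int (coeff p i) * z ^ i)"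
        using p(2) by (simp add: n_def lessThan_Suc_atMost[symmetric])
      finally have zn: "z ^ n = (\<Sum>i<n. of_int (- coeff p i) * z ^ i)"
        by (simp add: sum_negf eq_neg_iff_add_eq_0)
      have "of_nat D * z ^ k = of_nat D * (z ^ n * z ^ (k - n))"
        using False by (simp flip: power_add)
      also have "\<dots> = (\<Sum>i<n. of_int (- coeff p i) * (of_nat D * z ^ (i + (k - n))))"
        unfolding zn by (simp add: sum_distrib_left sum_distrib_right power_add algebra_simps)
      also have "\<dots> \<in> L"
        by (intro L_sum L_scale less.IH) (use False in auto)
      finally show ?thesis .
    qed
  qed
  then show ?thesis
    using D0 that unfolding L_def s_def by blast
qed

text \<open>This is all that the approximation argument uses of the ring of integers. Any such ring
  that contains \<open>x\<close>, \<open>y\<close> and \<open>t\<close> will do.\<close>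

locale integral_ring =
  fixes R :: "complex set"
  assumes one: "1 \<in> R"
    and diff: "\<And>u v. u \<in> R \<Longrightarrow> v \<in> R \<Longrightarrow> u - v \<in> R"
    and mult: "\<And>u v. u \<in> R \<Longrightarrow> v \<in> R \<Longrightarrow> u * v \<in> R"
    and cmod_ge_1: "\<And>u. u \<in> R \<Longrightarrow> u \<noteq> 0 \<Longrightarrow> cmod u \<ge> 1"

lemma integral_ring_containing:
  assumes x: "x \<in> imag_quad_integers d" and y: "y \<in> imag_quad_integers d"
    and t: "t \<in> imag_quad_integers d"
  obtains R where "integral_ring R" "x \<in> R" "y \<in> R" "t \<in> R"
proof -
  define s where "s = csqrt (- of_nat d)"
  have s2: "s * s = - of_nat d"
    unfolding s_def by (metis power2_csqrt power2_eq_square)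
  define L where "L = {of_int a + of_int b * s | a b. True}"
  have L_diff: "u - v \<in> L" if "u \<in> L" "v \<in> L" for u v
  proof -
    from that obtain a b a' b' where "u = of_int a + of_int b * s" "v = of_int a' + of_int b' * s"
      unfolding L_def by blast
    then have "u - v = of_int (a - a') + of_int (b - b') * s"
      by (simp add: algebra_simps)
    then show ?thesis unfolding L_def by blast
  qed
  have L_mult: "u * v \<in> L" if "u \<in> L" "v \<in> L" for u v
  proof -
    from that obtain a b a' b' where uv: "u = of_int a + of_int b * s" "v = of_int a' + of_int b' * s"
      unfolding L_def by blast
    have "u * v = of_int (a * a') + of_int (b * b') * (s * s) + of_int (a * b' + a' * b) * s"
      by (simp add: uv algebra_simps)
    also have "\<dots> = of_int (a * a' - b * b' * int d) + of_int (a * b' + a' * b) * s"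
      unfolding s2 by (simp add: algebra_simps)
    finally show ?thesis unfolding L_def by blast
  qed
  obtain Dx where Dx: "Dx > 0" "\<And>k. of_nat Dx * x ^ k \<in> L"
    using powers_bounded_denominator[OF x] unfolding L_def s_def by (smt (verit) mem_Collect_eq)
  obtain Dy where Dy: "Dy > 0" "\<And>k. of_nat Dy * y ^ k \<in> L"
    using powers_bounded_denominator[OF y] unfolding L_def s_def by (smt (verit) mem_Collect_eq)
  obtain Dt where Dt: "Dt > 0" "\<And>k. of_nat Dt * t ^ k \<in> L"
    using powers_bounded_denominator[OF t] unfolding L_def s_def by (smt (verit) mem_Collect_eq)
  define D where "D = Dx * Dy * Dt"
  txt \<open>All monomials in \<open>x, y, t\<close> have the common denominator \<open>D\<close>, so the multiplier ring of the
    module \<open>M\<close> below contains \<open>x, y, t\<close>, and the powers of each of its elements have denominator \<open>D\<close>.\<close>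
  define M where "M = {m. \<forall>i j l. of_nat D * (x ^ i * y ^ j * t ^ l * m) \<in> L}"
  define R where "R = {e. \<forall>m\<in>M. e * m \<in> M}"
  have "1 \<in> M"
  proof -
    have "of_nat D * (x ^ i * y ^ j * t ^ l * 1) \<in> L" for i j l
      using L_mult[OF L_mult[OF Dx(2)[of i] Dy(2)[of j]] Dt(2)[of l]]
      by (simp add: D_def mult_ac)
    then show ?thesis unfolding M_def by blast
  qed
  show thesis
  proof (rule that[of R])
    have "of_nat D * (x ^ i * y ^ j * t ^ l * (x * m)) \<in> L"
      "of_nat D * (x ^ i * y ^ j * t ^ l * (y * m)) \<in> L"
      "of_nat D * (x ^ i * y ^ j * t ^ l * (t * m)) \<in> L" if "m \<in> M" for m i j l
    proof -
      have m: "of_nat D * (x ^ i * y ^ j * t ^ l * m) \<in> L" for i j l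
        using that unfolding M_def by blast
      show "of_nat D * (x ^ i * y ^ j * t ^ l * (x * m)) \<in> L"
        using m[of "Suc i" j l] by (simp add: mult_ac)
      show "of_nat D * (x ^ i * y ^ j * t ^ l * (y * m)) \<in> L"
        using m[of i "Suc j" l] by (simp add: mult_ac)
      show "of_nat D * (x ^ i * y ^ j * t ^ l * (t * m)) \<in> L"
        using m[of i j "Suc l"] by (simp add: mult_ac)
    qed
    then show "x \<in> R" "y \<in> R" "t \<in> R"
      unfolding R_def M_def by blast+
    show "integral_ring R"
    proof
      show "1 \<in> R" unfolding R_def by simp
      have M_diff: "u - v \<in> M" if "u \<in> M" "v \<in> M" for u v
        using that L_diff unfolding M_def by (simp add: right_diff_distrib)
      show "u - v \<in> R" if "u \<in> R" "v \<in> R" for u v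
        using that M_diff unfolding R_def by (simp add: left_diff_distrib)
      show "u * v \<in> R" if "u \<in> R" "v \<in> R" for u v
        using that unfolding R_def by (simp add: mult.assoc)
      show "cmod u \<ge> 1" if u: "u \<in> R" "u \<noteq> 0" for u
      proof (rule cmod_ge_1_of_bounded_denominators[of D _ d])
        show "D > 0" using Dx Dy Dt by (simp add: D_def)
        fix k
        have "u ^ k \<in> M"
          using u(1) \<open>1 \<in> M\<close> by (induction k) (auto simp: R_def)
        then have "of_nat D * (x ^ 0 * y ^ 0 * t ^ 0 * u ^ k) \<in> L"
          unfolding M_def by blast
        then show "\<exists>a b::int. of_nat D * u ^ k = of_int a + of_int b * csqrt (- of_nat d)"
          unfolding L_def s_def by simp
      qed (rule u(2))
    qed
  qed
qed

text \<open>After multiplication by \<open>D\<close> all powers of \<open>z\<close> are lattice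
  points on the circle of radius \<open>D\<close>. There are finitely many of them, since
  \<open>d > 0\<close> bounds \<open>b\<close> as well as \<open>a\<close>, so two powers
  coincide.\<close>

lemma root_of_unity_if_cmod_1:
  assumes "z \<in> imag_quad_integers d" "cmod z = 1" "d > 0"
  shows "root_of_unity z"
proof -
  obtain D :: nat where D: "D > 0"
    "\<And>k. \<exists>a b::int. of_nat D * z ^ k = of_int a + of_int b * csqrt (- of_nat d)"
    using powers_bounded_denominator[OF assms(1)] by blast
  define N where "N = int D"
  define P where "P = (\<lambda>(a, b). (of_int a + of_int b * csqrt (- of_nat d)) / of_nat D) ` ({-N..N} \<times> {-N..N})"
  have "z ^ k \<in> P" for k
  proof -
    obtain a b :: int where ab: "of_nat D * z ^ k = of_int a + of_int b * csqrt (- of_nat d)"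
      using D(2) by blast
    have cs: "csqrt (- of_nat d) = \<i> * of_real (sqrt (real d))"
      by (simp add: complex_eq_iff csqrt.simps)
    have "(cmod (of_nat D * z ^ k))\<^sup>2 = real_of_int (a\<^sup>2 + b\<^sup>2 * int d)"
      unfolding cmod_power2 ab cs by (simp add: power_mult_distrib)
    moreover have "(cmod (of_nat D * z ^ k))\<^sup>2 = real_of_int (N\<^sup>2)"
      using assms(2) by (simp add: norm_mult norm_power N_def)
    ultimately have eq: "a\<^sup>2 + b\<^sup>2 * int d = N\<^sup>2" by linarith
    have "b\<^sup>2 * 1 \<le> b\<^sup>2 * int d"
      using assms(3) by (intro mult_left_mono) auto
    then have "a\<^sup>2 \<le> N\<^sup>2" "b\<^sup>2 \<le> N\<^sup>2"
      using eq zero_le_power2[of a] zero_le_power2[of b] by linarith+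
    then have "\<bar>a\<bar> \<le> N" "\<bar>b\<bar> \<le> N"
      by (simp_all add: abs_le_square_iff[symmetric] N_def)
    then have "(a, b) \<in> {-N..N} \<times> {-N..N}" by auto
    moreover have "z ^ k = (of_int a + of_int b * csqrt (- of_nat d)) / of_nat D"
      using ab D(1) by (simp add: field_simps)
    ultimately show ?thesis unfolding P_def by force
  qed
  then have "range (\<lambda>k. z ^ k) \<subseteq> P" by blast
  moreover have "finite P" unfolding P_def by simp
  ultimately have "finite (range (\<lambda>k. z ^ k))" by (rule finite_subset)
  then have "\<not> inj (\<lambda>k::nat. z ^ k)"
    using finite_imageD infinite_UNIV_nat by blast
  then obtain i j :: nat where "i < j" "z ^ i = z ^ j"
    by (metis injI linorder_neqE_nat)
  moreover have "z \<noteq> 0" using assms(2) by auto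
  ultimately have "z ^ (j - i) = 1"
    by (simp add: power_diff)
  then show ?thesis
    unfolding root_of_unity_def using \<open>i < j\<close> by (intro exI[of _ "j - i"]) simp
qed

subsection \<open>Pade approximants to powers of 1 - z\<close>

text \<open>For \<open>u\<close> nonzero this is \<open>u ^ n * ((2 * n) choose n)\<close> times the
  hypergeometric polynomial 2F1(-n, -n-a; -2n; 1 - w/u). It is expanded in powers of
  \<open>w - u\<close> because this difference is \<open>-8\<close> in the application.\<close>

definition pade :: "complex \<Rightarrow> nat \<Rightarrow> complex \<Rightarrow> complex \<Rightarrow> complex" where
  "pade a n u w = (\<Sum>k\<le>n. ((of_nat n + a) gchoose k) * of_nat ((2 * n - k) choose n) *
     u ^ (n - k) * (w - u) ^ k)"

lemma gbinomial_revision: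
  fixes a :: "'a::field_char_0"
  shows "(a gchoose k) * ((a - of_nat k) gchoose m) = (a gchoose m) * ((a - of_nat m) gchoose k)"
proof -
  have "(a gchoose k) * ((a - of_nat k) gchoose m) = (a gchoose (k + m)) * of_nat ((k + m) choose k)"
    using gbinomial_trinomial_revision[of k "k + m" a]
    by (simp add: binomial_gbinomial)
  moreover have "(a gchoose m) * ((a - of_nat m) gchoose k) = (a gchoose (k + m)) * of_nat ((k + m) choose m)"
    using gbinomial_trinomial_revision[of m "k + m" a]
    by (simp add: binomial_gbinomial)
  moreover have "(k + m) choose k = (k + m) choose m"
    by (metis add_diff_cancel_left' binomial_symmetric le_add1)
  ultimately show ?thesis by simp
qed

lemma gbinomial_mult_binomial:
  fixes b :: "'a::field_char_0"
  assumes "k \<le> j"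
  shows "(b gchoose j) * of_nat (j choose k) = (b gchoose k) * ((b - of_nat k) gchoose (j - k))"
  using gbinomial_trinomial_revision[OF assms, of b] by (simp add: binomial_gbinomial)

text \<open>Expand \<open>w ^ j\<close> around \<open>u\<close> and sum over \<open>j\<close> by
  Vandermonde; the upper entries \<open>n + a - k\<close> and \<open>n - a\<close> add up to the
  integer \<open>2 * n - k\<close>. In this form the symmetry \<open>pade_swap\<close> is a mere
  reversal of the sum.\<close>

lemma pade_altdef:
  "pade a n u w = (\<Sum>j\<le>n. ((of_nat n + a) gchoose j) * ((of_nat n - a) gchoose (n - j)) * w ^ j * u ^ (n - j))"
proof -
  let ?b = "of_nat n + a" and ?c = "of_nat n - a"
  have w: "w ^ j = (\<Sum>k\<le>j. of_nat (j choose k) * (w - u) ^ k * u ^ (j - k))" for j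
    using binomial_ring[of "w - u" u j] by simp
  have "(\<Sum>j\<le>n. (?b gchoose j) * (?c gchoose (n - j)) * w ^ j * u ^ (n - j)) =
      (\<Sum>j\<le>n. \<Sum>k\<le>j. (?b gchoose k) * ((?b - of_nat k) gchoose (j - k)) * (?c gchoose (n - j)) *
         (w - u) ^ k * u ^ (n - k))"
  proof (intro sum.cong refl)
    fix j assume j: "j \<in> {..n}"
    have "(?b gchoose j) * (?c gchoose (n - j)) * w ^ j * u ^ (n - j) =
       (\<Sum>k\<le>j. ((?b gchoose j) * of_nat (j choose k)) * (?c gchoose (n - j)) *
         (w - u) ^ k * (u ^ (j - k) * u ^ (n - j)))"
      unfolding w by (simp add: sum_distrib_left sum_distrib_right mult_ac)
    also have "\<dots> = (\<Sum>k\<le>j. (?b gchoose k) * ((?b - of_nat k) gchoose (j - k)) * (?c gchoose (n - j)) *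
         (w - u) ^ k * u ^ (n - k))"
      using j by (intro sum.cong refl) (simp add: gbinomial_mult_binomial flip: power_add)
    finally show "(?b gchoose j) * (?c gchoose (n - j)) * w ^ j * u ^ (n - j) = \<dots>" .
  qed
  also have "\<dots> = (\<Sum>k\<le>n. \<Sum>j=k..n. (?b gchoose k) * ((?b - of_nat k) gchoose (j - k)) * (?c gchoose (n - j)) *
         (w - u) ^ k * u ^ (n - k))"
    unfolding sum.Sigma[OF finite_atMost ballI[OF finite_atMost]]
      sum.Sigma[OF finite_atMost ballI[OF finite_atLeastAtMost]]
    by (intro sum.reindex_bij_witness[of _ "\<lambda>(k, j). (j, k)" "\<lambda>(j, k). (k, j)"]) auto
  also have "\<dots> = pade a n u w"
    unfolding pade_def
  proof (intro sum.cong refl)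
    fix k assume k: "k \<in> {..n}"
    have "(\<Sum>j=k..n. ((?b - of_nat k) gchoose (j - k)) * (?c gchoose (n - j))) =
      (\<Sum>i=0..n-k. ((?b - of_nat k) gchoose i) * (?c gchoose (n - k - i)))"
      using k by (intro sum.reindex_bij_witness[of _ "\<lambda>i. i + k" "\<lambda>j. j - k"]) auto
    also have "\<dots> = (?b - of_nat k + ?c) gchoose (n - k)"
      by (rule gbinomial_Vandermonde)
    also have "?b - of_nat k + ?c = of_nat (2 * n - k)"
      using k by (simp add: of_nat_diff)
    also have "(of_nat (2 * n - k) gchoose (n - k) :: complex) = of_nat ((2 * n - k) choose (n - k))"
      by (simp add: binomial_gbinomial)
    also have "(2 * n - k) choose (n - k) = (2 * n - k) choose n"
      using k binomial_symmetric[of "n - k" "2 * n - k"] by simp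
    finally have V: "(\<Sum>j=k..n. ((?b - of_nat k) gchoose (j - k)) * (?c gchoose (n - j))) =
      of_nat ((2 * n - k) choose n)" .
    have "(\<Sum>j=k..n. (?b gchoose k) * ((?b - of_nat k) gchoose (j - k)) * (?c gchoose (n - j)) *
         (w - u) ^ k * u ^ (n - k)) =
       (?b gchoose k) * (\<Sum>j=k..n. ((?b - of_nat k) gchoose (j - k)) * (?c gchoose (n - j))) *
         u ^ (n - k) * (w - u) ^ k"
      by (simp add: sum_distrib_left sum_distrib_right mult_ac)
    then show "(\<Sum>j=k..n. (?b gchoose k) * ((?b - of_nat k) gchoose (j - k)) * (?c gchoose (n - j)) *
         (w - u) ^ k * u ^ (n - k)) = (?b gchoose k) * of_nat ((2 * n - k) choose n) *
         u ^ (n - k) * (w - u) ^ k"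
      unfolding V .
  qed
  finally show ?thesis ..
qed

lemma pade_swap: "pade a n u w = pade (- a) n w u"
  unfolding pade_altdef
  by (intro sum.reindex_bij_witness[of _ "\<lambda>j. n - j" "\<lambda>j. n - j"]) (auto simp: mult_ac)

lemma pade_homogeneous: "pade a n (c * u) (c * w) = c ^ n * pade a n u w"
proof -
  have "c ^ n * pade a n u w = (\<Sum>k\<le>n. (c ^ (n - k) * c ^ k) * (((of_nat n + a) gchoose k) *
     of_nat ((2 * n - k) choose n) * u ^ (n - k) * (w - u) ^ k))"
    unfolding pade_def sum_distrib_left by (intro sum.cong refl) (simp flip: power_add)
  then show ?thesis
    unfolding pade_def
    by (simp add: power_mult_distrib mult_ac flip: right_diff_distrib)
qed

text \<open>By \<open>pade_swap\<close> the left polynomial is a combination of powers of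
  \<open>1 - z\<close>, and the binomial series expands the product of each with
  \<open>(1 - z) powr a\<close>. In the coefficient of \<open>(- z) ^ m\<close>,
  \<open>gbinomial_revision\<close> makes one factor independent of \<open>j\<close>, and
  Vandermonde sums the others.\<close>

lemma pade_sums:
  assumes "cmod z < 1"
  shows "(\<lambda>m. ((of_nat n + a) gchoose m) * ((2 * of_nat n - of_nat m) gchoose n) * (- z) ^ m) sums
    ((1 - z) powr a * pade a n (1 - z) 1)"
proof -
  let ?b = "of_nat n + a" and ?c = "of_nat n - a"
  have z1: "1 - z \<noteq> 0" using assms by auto
  have S: "(\<lambda>m. (((a + of_nat j) gchoose m) * (- z) ^ m)) sums ((1 - z) powr a * (1 - z) ^ j)" for j
  proof -
    have "(\<lambda>m. ((a + of_nat j) gchoose m) * (- z) ^ m) sums (1 + (- z)) powr (a + of_nat j)"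
      using assms by (intro gen_binomial_complex) simp
    moreover have "(1 + (- z)) powr (a + of_nat j) = (1 - z) powr a * (1 - z) ^ j"
      using z1 by (simp add: powr_add powr_nat')
    ultimately show ?thesis by simp
  qed
  have "(\<lambda>m. \<Sum>j\<le>n. (?b gchoose (n - j)) * (?c gchoose j) * (((a + of_nat j) gchoose m) * (- z) ^ m)) sums
     (\<Sum>j\<le>n. (?b gchoose (n - j)) * (?c gchoose j) * ((1 - z) powr a * (1 - z) ^ j))"
    by (intro sums_sum sums_mult S)
  moreover have "(\<Sum>j\<le>n. (?b gchoose (n - j)) * (?c gchoose j) * ((1 - z) powr a * (1 - z) ^ j)) =
     (1 - z) powr a * pade a n (1 - z) 1"
    unfolding pade_swap[of a n "1 - z" 1] unfolding pade_altdef
    by (simp add: sum_distrib_left mult_ac)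
  moreover have "(\<Sum>j\<le>n. (?b gchoose (n - j)) * (?c gchoose j) * (((a + of_nat j) gchoose m) * (- z) ^ m)) =
     (?b gchoose m) * ((2 * of_nat n - of_nat m) gchoose n) * (- z) ^ m" for m
  proof -
    have "(?b gchoose (n - j)) * ((a + of_nat j) gchoose m) =
        (?b gchoose m) * ((?b - of_nat m) gchoose (n - j))" if "j \<le> n" for j
      using gbinomial_revision[of ?b "n - j" m] that by (simp add: of_nat_diff algebra_simps)
    then have "(\<Sum>j\<le>n. (?b gchoose (n - j)) * (?c gchoose j) * (((a + of_nat j) gchoose m) * (- z) ^ m)) =
      (\<Sum>j\<le>n. (?b gchoose m) * (- z) ^ m * ((?c gchoose j) * ((?b - of_nat m) gchoose (n - j))))"
      by (intro sum.cong refl) (simp add: mult_ac)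
    also have "\<dots> = (?b gchoose m) * (- z) ^ m *
        (\<Sum>j=0..n. (?c gchoose j) * ((?b - of_nat m) gchoose (n - j)))"
      by (simp add: sum_distrib_left atLeast0AtMost)
    also have "(\<Sum>j=0..n. (?c gchoose j) * ((?b - of_nat m) gchoose (n - j))) =
        ((?c + (?b - of_nat m)) gchoose n)"
      by (rule gbinomial_Vandermonde)
    also have "?c + (?b - of_nat m) = 2 * of_nat n - of_nat m" by simp
    finally show ?thesis by (simp add: mult_ac)
  qed
  ultimately show ?thesis by simp
qed

text \<open>In the series of \<open>pade_sums\<close> the terms with index in \<open>{n<..2 * n}\<close> vanish, and those up to \<open>n\<close> add up
  to \<open>pade a n 1 (1 - z)\<close>; the remaining tail is the approximation error.\<close>

definition pade_error :: "complex \<Rightarrow> nat \<Rightarrow> complex \<Rightarrow> complex" where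
  "pade_error a n z = (1 - z) powr a * pade a n (1 - z) 1 - pade a n 1 (1 - z)"

lemma pade_error_sums:
  assumes "cmod z < 1"
  shows "(\<lambda>i. ((of_nat n + a) gchoose (2 * n + 1 + i)) * ((-1) ^ n * of_nat ((n + i) choose n)) *
      (- z) ^ (2 * n + 1 + i)) sums pade_error a n z"
proof -
  let ?f = "\<lambda>m. ((of_nat n + a) gchoose m) * ((2 * of_nat n - of_nat m) gchoose n) * (- z) ^ m"
  have f_low: "?f m = ((of_nat n + a) gchoose m) * of_nat ((2 * n - m) choose n) * (- z) ^ m"
    if "m < 2 * n + 1" for m
    using that by (simp add: binomial_gbinomial of_nat_diff)
  have "(\<Sum>m<2 * n + 1. ?f m) =
      (\<Sum>m<2 * n + 1. ((of_nat n + a) gchoose m) * of_nat ((2 * n - m) choose n) * (- z) ^ m)"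
    by (intro sum.cong refl f_low) auto
  also have "\<dots> = (\<Sum>m\<le>n. ((of_nat n + a) gchoose m) * of_nat ((2 * n - m) choose n) * (- z) ^ m)"
    by (intro sum.mono_neutral_right) (auto simp: binomial_eq_0)
  also have "\<dots> = pade a n 1 (1 - z)"
    unfolding pade_def by simp
  finally have low: "(\<Sum>m<2 * n + 1. ?f m) = pade a n 1 (1 - z)" .
  have "(\<lambda>i. ?f (i + (2 * n + 1))) sums ((1 - z) powr a * pade a n (1 - z) 1 - (\<Sum>m<2 * n + 1. ?f m))"
    by (rule sums_split_initial_segment[OF pade_sums[OF assms]])
  moreover have "((2 * of_nat n - of_nat (2 * n + 1 + i)) gchoose n :: complex) = (-1) ^ n * of_nat ((n + i) choose n)" for i
  proof -
    have "((2 * of_nat n - of_nat (2 * n + 1 + i)) gchoose n :: complex) = ((- (of_nat i + 1)) gchoose n)"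
      by (simp add: algebra_simps)
    also have "\<dots> = (-1) ^ n * ((of_nat i + 1 + of_nat n - 1) gchoose n)"
      by (rule gbinomial_minus)
    also have "of_nat i + 1 + of_nat n - 1 = (of_nat (n + i) :: complex)" by simp
    finally show ?thesis by (simp add: binomial_gbinomial)
  qed
  ultimately show ?thesis
    unfolding low pade_error_def by (simp add: add_ac)
qed

section \<open>Bounds for the approximants and their error\<close>

lemma Suc_times_gbinomial_Suc:
  fixes a :: "'a::field_char_0"
  shows "of_nat (Suc k) * (a gchoose Suc k) = (a - of_nat k) * (a gchoose k)"
  using gbinomial_mult_1[of a k] by (simp only: left_diff_distrib) simp

text \<open>From \<open>n\<close> to \<open>n + 1\<close> the norm is multiplied by
  \<open>(n + 5/4) * (n + 3/4) / ((2 * n + 3) * (2 * n + 2))\<close>, whose numerator is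
  \<open>(n + 1)\<^sup>2 - 1/16\<close>.\<close>

lemma norm_gbinomial_quarter_centre:
  "norm ((of_nat n + 1/4 :: complex) gchoose (2 * n + 1)) \<le> (fact n)\<^sup>2 / (4 * fact (2 * n + 1))"
proof (induction n)
  case (Suc n)
  let ?b = "of_nat n + 1/4 :: complex"
  have 1: "(of_nat (Suc n) + 1/4 :: complex) gchoose (2 * Suc n + 1) =
      (?b + 1) / of_nat (2 * n + 3) * (?b gchoose (2 * n + 2))"
    using gbinomial_factors[of ?b "2 * n + 2"] by (simp add: add_ac eval_nat_numeral)
  have 2: "?b gchoose (2 * n + 2) = (?b - of_nat (2 * n + 1)) / of_nat (2 * n + 2) * (?b gchoose (2 * n + 1))"
  proof -
    have "of_nat (2 * n + 2) * (?b gchoose (2 * n + 2)) = (?b - of_nat (2 * n + 1)) * (?b gchoose (2 * n + 1))"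
      using Suc_times_gbinomial_Suc[of "2 * n + 1" ?b] by simp
    moreover have "of_nat (2 * n + 2) \<noteq> (0 :: complex)"
      by (simp only: of_nat_eq_0_iff)
    ultimately show ?thesis
      by (metis nonzero_mult_div_cancel_left times_divide_eq_left)
  qed
  have n1: "norm (?b + 1) = real n + 5/4"
    using norm_of_real[of "real n + 5/4", where 'a=complex] by (simp add: add_ac)
  have n2: "norm (?b - of_nat (2 * n + 1)) = real n + 3/4"
  proof -
    have "?b - of_nat (2 * n + 1) = - of_real (real n + 3/4)" by simp
    then show ?thesis by (simp only: norm_minus_cancel norm_of_real)
  qed
  have "norm ((of_nat (Suc n) + 1/4 :: complex) gchoose (2 * Suc n + 1)) =
     ((real n + 5/4) * (real n + 3/4)) / (real (2 * n + 3) * real (2 * n + 2)) * norm (?b gchoose (2 * n + 1))"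
    unfolding 1 2 norm_mult norm_divide n1 n2 norm_of_nat by simp
  also have "\<dots> \<le> (real n + 1)\<^sup>2 / (real (2 * n + 3) * real (2 * n + 2)) * ((fact n)\<^sup>2 / (4 * fact (2 * n + 1)))"
    by (intro mult_mono divide_right_mono Suc.IH) (auto simp: power2_eq_square algebra_simps)
  also have "\<dots> = (fact (Suc n))\<^sup>2 / (4 * fact (2 * Suc n + 1))"
    by (simp add: field_simps power2_eq_square eval_nat_numeral)
  finally show ?case .
qed simp

text \<open>The ratio of consecutive norms is \<open>(n + i + 3/4) / (2 * n + 2 + i) < 1\<close>, so
  the first one dominates.\<close>

lemma norm_gbinomial_quarter_tail:
  "norm ((of_nat n + 1/4 :: complex) gchoose (2 * n + 1 + i)) \<le> (fact n)\<^sup>2 / (4 * fact (2 * n + 1))"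
proof (induction i)
  case 0
  then show ?case using norm_gbinomial_quarter_centre[of n] by simp
next
  case (Suc i)
  let ?b = "of_nat n + 1/4 :: complex" and ?m = "2 * n + 1 + i"
  have "of_nat (Suc ?m) * (?b gchoose Suc ?m) = (?b - of_nat ?m) * (?b gchoose ?m)"
    by (rule Suc_times_gbinomial_Suc)
  then have eq: "real (Suc ?m) * norm (?b gchoose Suc ?m) = norm (?b - of_nat ?m) * norm (?b gchoose ?m)"
    by (metis norm_mult norm_of_nat)
  have "?b - of_nat ?m = - of_real (real n + real i + 3/4)" by simp
  then have "norm (?b - of_nat ?m) = real n + real i + 3/4"
    by (simp only: norm_minus_cancel norm_of_real)
  then have "real (Suc ?m) * norm (?b gchoose Suc ?m) \<le> real (Suc ?m) * norm (?b gchoose ?m)"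
    unfolding eq by (intro mult_right_mono) auto
  then have "norm (?b gchoose Suc ?m) \<le> norm (?b gchoose ?m)"
    by (simp add: mult_le_cancel_left)
  with Suc show ?case by simp
qed

lemma negative_binomial_sums:
  fixes r :: real
  assumes "0 \<le> r" "r < 1"
  shows "(\<lambda>i. real ((n + i) choose n) * r ^ i) sums (1 / (1 - r) ^ (n + 1))"
proof -
  have "(\<lambda>i. ((- (real n + 1)) gchoose i) * (- r) ^ i) sums (1 + (- r)) powr (- (real n + 1))"
    using assms by (intro gen_binomial_real) auto
  moreover have "((- (real n + 1)) gchoose i) * (- r) ^ i = real ((n + i) choose n) * r ^ i" for i
  proof -
    have "(- (real n + 1)) gchoose i = (-1) ^ i * ((real n + 1 + real i - 1) gchoose i)"
      by (rule gbinomial_minus)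
    also have "real n + 1 + real i - 1 = real (n + i)" by simp
    also have "real (n + i) gchoose i = real ((n + i) choose i)"
      by (simp add: binomial_gbinomial)
    also have "(n + i) choose i = (n + i) choose n"
      using binomial_symmetric[of i "n + i"] by simp
    finally show ?thesis by (simp add: power_minus')
  qed
  moreover have "(1 + (- r)) powr (- (real n + 1)) = 1 / (1 - r) ^ (n + 1)"
    using assms powr_realpow[of "1 - r" "n + 1"]
    by (simp only: powr_minus divide_inverse) (simp add: add.commute)
  ultimately show ?thesis by simp
qed

text \<open>With the generalised binomials bounded uniformly, the series of
  \<open>pade_error_sums\<close> is dominated by a negative binomial series.\<close>

lemma norm_pade_error_le:
  assumes "cmod z < 1"
  shows "cmod (pade_error (1/4) n z) \<le>
    (fact n)\<^sup>2 / (4 * fact (2 * n + 1)) * cmod z ^ (2 * n + 1) / (1 - cmod z) ^ (n + 1)"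
proof -
  let ?B = "(fact n)\<^sup>2 / (4 * fact (2 * n + 1)) :: real"
  let ?f = "\<lambda>i. ((of_nat n + 1/4) gchoose (2 * n + 1 + i)) * ((-1) ^ n * of_nat ((n + i) choose n)) *
      (- z) ^ (2 * n + 1 + i) :: complex"
  let ?g = "\<lambda>i. ?B * cmod z ^ (2 * n + 1) * (real ((n + i) choose n) * cmod z ^ i)"
  have g: "?g sums (?B * cmod z ^ (2 * n + 1) * (1 / (1 - cmod z) ^ (n + 1)))"
    using assms by (intro sums_mult negative_binomial_sums) auto
  have "norm (?f i) \<le> ?g i" for i
  proof -
    have "norm (?f i) = norm ((of_nat n + 1/4 :: complex) gchoose (2 * n + 1 + i)) *
        (cmod z ^ (2 * n + 1) * (real ((n + i) choose n) * cmod z ^ i))"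
      by (simp only: norm_mult norm_power norm_minus_cancel norm_of_nat power_add norm_one power_one mult_ac mult_1)
    also have "\<dots> \<le> ?B * (cmod z ^ (2 * n + 1) * (real ((n + i) choose n) * cmod z ^ i))"
      by (intro mult_right_mono norm_gbinomial_quarter_tail) auto
    finally show ?thesis by (simp only: mult.assoc)
  qed
  then have "norm (suminf ?f) \<le> suminf ?g"
    using g by (intro norm_suminf_le) (auto simp: sums_iff)
  then show ?thesis
    using g pade_error_sums[OF assms, of n "1/4"] by (simp add: sums_iff)
qed

text \<open>Lowering the upper entry from \<open>m + 1\<close> to \<open>m\<close> multiplies the
  binomial by \<open>(m + 1 - n) / (m + 1)\<close>, which is at most \<open>1/2\<close> as long as
  \<open>m + 1 \<le> 2 * n\<close>.\<close>

lemma binomial_half_decay: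
  assumes "k \<le> n"
  shows "real ((2 * n - k) choose n) \<le> real ((2 * n) choose n) / 2 ^ k"
  using assms
proof (induction k)
  case (Suc k)
  define m where "m = 2 * n - Suc k"
  have m: "2 * n - k = Suc m" "n \<le> m" using Suc.prems by (auto simp: m_def)
  have "(Suc m - n) * (Suc m choose n) = Suc m * (m choose n)"
    using binomial_absorb_comp[of "Suc m" n] by simp
  then have "real (Suc m) * real (m choose n) = real (Suc m - n) * real (Suc m choose n)"
    by (metis of_nat_mult)
  also have "\<dots> \<le> real (Suc m) / 2 * real (Suc m choose n)"
    using m Suc.prems by (intro mult_right_mono) auto
  finally have "real (Suc m) * real (m choose n) \<le> real (Suc m) * (real (Suc m choose n) / 2)"
    by simp
  then have "real (m choose n) \<le> real (Suc m choose n) / 2"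
    by (subst (asm) mult_le_cancel_left_pos) auto
  also have "\<dots> \<le> real ((2 * n) choose n) / 2 ^ k / 2"
    using Suc m(1) by (intro divide_right_mono) auto
  finally show ?case by (simp add: m_def mult.commute)
qed simp

lemma norm_gbinomial_quarter_le:
  assumes "k \<le> n"
  shows "norm ((of_nat n + 1/4 :: complex) gchoose k) \<le> real ((n + 1) choose k)"
proof -
  have "(of_nat n + 1/4 :: complex) gchoose k = of_real ((real n + 1/4) gchoose k)"
    by (simp add: gbinomial_prod_rev)
  moreover have "0 \<le> (real n + 1/4) gchoose k"
    using assms by (auto simp: gbinomial_prod_rev intro!: divide_nonneg_pos prod_nonneg)
  moreover have "(real n + 1/4) gchoose k \<le> real (n + 1) gchoose k"
    using assms by (intro gbinomial_mono) auto
  ultimately show ?thesis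
    by (simp add: binomial_gbinomial)
qed

text \<open>The decay \<open>1 / 2 ^ k\<close> of the binomials cancels the 2 in
  \<open>2 * h\<close>, and a truncated expansion of \<open>(cmod u + h) ^ (n + 1)\<close> remains.
  The exponent \<open>n + 1\<close> comes from comparing \<open>n + 1/4\<close> with
  \<open>n + 1\<close>.\<close>

lemma norm_pade_le:
  assumes "cmod (w - u) \<le> 2 * h" "u \<noteq> 0"
  shows "cmod (pade (1/4) n u w) \<le> real ((2 * n) choose n) * (cmod u + h) ^ (n + 1) / cmod u"
proof -
  have h: "0 \<le> h" using assms(1) norm_ge_zero[of "w - u"] by linarith
  let ?C = "real ((2 * n) choose n)"
  have "cmod (pade (1/4) n u w) \<le> (\<Sum>k\<le>n. real ((n + 1) choose k) * (?C / 2 ^ k) * cmod u ^ (n - k) * (2 * h) ^ k)"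
    unfolding pade_def
  proof (intro sum_norm_le)
    fix k assume "k \<in> {..n}"
    then show "cmod (((of_nat n + 1/4) gchoose k) * of_nat ((2 * n - k) choose n) * u ^ (n - k) * (w - u) ^ k)
        \<le> real ((n + 1) choose k) * (?C / 2 ^ k) * cmod u ^ (n - k) * (2 * h) ^ k"
      unfolding norm_mult norm_power norm_of_nat
      by (intro mult_mono norm_gbinomial_quarter_le binomial_half_decay power_mono assms) (auto simp: h)
  qed
  also have "\<dots> = (\<Sum>k\<le>n. ?C / cmod u * (real ((n + 1) choose k) * h ^ k * cmod u ^ (n + 1 - k)))"
    using assms(2) by (intro sum.cong refl) (auto simp: power_mult_distrib Suc_diff_le field_simps)
  also have "\<dots> \<le> (\<Sum>k\<le>n + 1. ?C / cmod u * (real ((n + 1) choose k) * h ^ k * cmod u ^ (n + 1 - k)))"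
    using h by (intro sum_mono2) auto
  also have "\<dots> = ?C / cmod u * (h + cmod u) ^ (n + 1)"
    by (simp only: binomial_ring sum_distrib_left mult_ac)
  finally show ?thesis by (simp add: add.commute)
qed

section \<open>Independence of consecutive approximants\<close>

text \<open>The bound forces a zero of order \<open>N\<close> at 0, and the degree leaves room for
  nothing else. The induction strips one factor \<open>z\<close> at a time.\<close>

lemma poly_eq_monom_of_order:
  fixes p :: "complex poly"
  assumes "degree p \<le> N" and "\<And>z. cmod z \<le> 1/2 \<Longrightarrow> cmod (poly p z) \<le> B * cmod z ^ N"
  shows "p = monom (coeff p N) N"
  using assms
proof (induction N arbitrary: p)
  case 0
  then show ?case
    by (metis degree_0_id le_zero_eq monom_0)
next
  case (Suc N)
  have p0: "coeff p 0 = 0"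
    using Suc.prems(2)[of 0] by (simp add: poly_0_coeff_0)
  obtain q where p: "p = pCons 0 q"
    using p0 by (metis coeff_pCons_0 pCons_cases)
  have "q = monom (coeff q N) N"
  proof (rule Suc.IH)
    show "degree q \<le> N"
      using Suc.prems(1) unfolding p by (cases "q = 0") auto
    show "cmod (poly q z) \<le> B * cmod z ^ N" if z: "cmod z \<le> 1/2" for z
    proof (cases "z = 0")
      case False
      have "cmod z * cmod (poly q z) \<le> cmod z * (B * cmod z ^ N)"
        using Suc.prems(2)[OF z] unfolding p by (simp add: norm_mult mult_ac)
      with False show ?thesis by (simp add: mult_le_cancel_left)
    next
      case True
      \<comment> \<open>At 0 the factor \<open>cmod z\<close> cannot be cancelled, so the bound is
        obtained there as a limit from nearby points.\<close>
      have lim: "((\<lambda>z. B * cmod z ^ N - cmod (poly q z)) \<longlongrightarrow> B * cmod 0 ^ N - cmod (poly q 0)) (at 0)"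
        by (intro tendsto_intros continuous_intros isContD[OF poly_isCont]) 
      have "B * cmod 0 ^ N - cmod (poly q 0) \<ge> 0"
      proof (rule tendsto_lowerbound[OF lim])
        show "\<forall>\<^sub>F z in at 0. 0 \<le> B * cmod z ^ N - cmod (poly q z)"
          unfolding eventually_at
        proof (intro exI[of _ "1/2"] conjI ballI impI)
          fix z :: complex assume z: "z \<noteq> 0 \<and> dist z 0 < 1/2"
          have "cmod z * cmod (poly q z) \<le> cmod z * (B * cmod z ^ N)"
            using Suc.prems(2)[of z] z unfolding p by (simp add: norm_mult mult_ac)
          with z show "0 \<le> B * cmod z ^ N - cmod (poly q z)" by (simp add: mult_le_cancel_left)
        qed auto
      qed auto
      with True show ?thesis by simp
    qed
  qed
  then have "pCons 0 q = pCons 0 (monom (coeff q N) N)" by simp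
  then show ?case unfolding p by (simp add: monom_Suc)
qed

definition pade_poly :: "complex \<Rightarrow> nat \<Rightarrow> complex poly" where
  "pade_poly a n = (\<Sum>k\<le>n. monom ((-1) ^ k * ((of_nat n + a) gchoose k) * of_nat ((2 * n - k) choose n)) k)"

lemma poly_pade_poly: "poly (pade_poly a n) z = pade a n 1 (1 - z)"
  unfolding pade_poly_def pade_def
  by (simp add: poly_sum poly_monom power_minus' mult_ac)

lemma degree_pade_poly: "degree (pade_poly a n) \<le> n"
  unfolding pade_poly_def by (intro degree_sum_le) (auto intro: order.trans[OF degree_monom_le])

lemma coeff_pade_poly: "coeff (pade_poly a n) n = (-1) ^ n * ((of_nat n + a) gchoose n)"
  unfolding pade_poly_def by (simp add: coeff_sum)

text \<open>The determinant is a polynomial in \<open>z\<close> of degree at most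
  \<open>2 * n + 1\<close>. Eliminating the root from the two error terms shows that it vanishes at
  0 to that same order, so it is a monomial, and its coefficient is computed from the leading
  coefficients.\<close>

lemma pade_determinant_ne_0:
  assumes "cmod z < 1" "z \<noteq> 0"
  shows "pade (1/4) n (1 - z) 1 * pade (1/4) (Suc n) 1 (1 - z) \<noteq>
         pade (1/4) n 1 (1 - z) * pade (1/4) (Suc n) (1 - z) 1"
proof -
  define S where "S = pade_poly (1/4)"
  define T where "T = pade_poly (- (1/4))"
  have S: "poly (S m) z = pade (1/4) m 1 (1 - z)" for m z
    by (simp add: S_def poly_pade_poly)
  have T: "poly (T m) z = pade (1/4) m (1 - z) 1" for m z
    using pade_swap[of "1/4" m "1 - z" 1] by (simp add: T_def poly_pade_poly)
  define p where "p = T n * S (Suc n) - S n * T (Suc n)"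
  have deg: "degree p \<le> 2 * n + 1"
    unfolding p_def S_def T_def
    by (intro degree_diff_le order.trans[OF degree_mult_le])
       (use add_mono[OF degree_pade_poly[of _ n] degree_pade_poly[of _ "Suc n"]] in \<open>simp_all add: mult_2\<close>)
  have "\<exists>B. \<forall>z. cmod z \<le> 1/2 \<longrightarrow> cmod (poly (T m) z) \<le> B" for m
  proof -
    have "bounded (poly (T m) ` cball 0 (1/2))"
      by (intro compact_imp_bounded compact_continuous_image continuous_intros) auto
    then show ?thesis
      unfolding bounded_iff by (auto simp: cball_def)
  qed
  then obtain B where B: "\<And>m z. cmod z \<le> 1/2 \<Longrightarrow> cmod (poly (T m) z) \<le> B m"
    by metis
  define c :: "nat \<Rightarrow> real" where "c m = (fact m)\<^sup>2 / (4 * fact (2 * m + 1)) * 2 ^ (m + 1)" for m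
  have c0: "c m \<ge> 0" for m by (simp add: c_def)
  have err: "cmod (pade_error (1/4) m z) \<le> c m * cmod z ^ (2 * m + 1)" if z: "cmod z \<le> 1/2" for m z
  proof -
    have "(1/2) ^ (m + 1) \<le> (1 - cmod z) ^ (m + 1)"
      using z by (intro power_mono) auto
    then have "1 / (1 - cmod z) ^ (m + 1) \<le> 1 / (1/2) ^ (m + 1)"
      by (rule divide_left_mono) (use z in auto)
    also have "\<dots> = 2 ^ (m + 1)" by (simp add: power_divide)
    finally have "1 / (1 - cmod z) ^ (m + 1) \<le> 2 ^ (m + 1)" .
    then have "(fact m)\<^sup>2 / (4 * fact (2 * m + 1)) * cmod z ^ (2 * m + 1) * (1 / (1 - cmod z) ^ (m + 1))
       \<le> (fact m)\<^sup>2 / (4 * fact (2 * m + 1)) * cmod z ^ (2 * m + 1) * 2 ^ (m + 1)"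
      by (intro mult_left_mono) auto
    then show ?thesis
      using norm_pade_error_le[of z m] z by (simp add: c_def mult_ac)
  qed
  have bound: "cmod (poly p z) \<le> (c n * B (Suc n) + c (Suc n) * B n) * cmod z ^ (2 * n + 1)"
    if z: "cmod z \<le> 1/2" for z
  proof -
    define e where "e m = pade_error (1/4) m z" for m
    have e: "e m = (1 - z) powr (1/4) * poly (T m) z - poly (S m) z" for m
      unfolding e_def pade_error_def S T ..
    have "poly p z = e n * poly (T (Suc n)) z - e (Suc n) * poly (T n) z"
      unfolding p_def e by (simp add: algebra_simps)
    also have "cmod \<dots> \<le> cmod (e n) * cmod (poly (T (Suc n)) z) + cmod (e (Suc n)) * cmod (poly (T n) z)"
      by (rule order.trans[OF norm_triangle_ineq4]) (simp add: norm_mult)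
    also have "\<dots> \<le> (c n * cmod z ^ (2 * n + 1)) * B (Suc n) + (c (Suc n) * cmod z ^ (2 * n + 1)) * B n"
    proof (intro add_mono mult_mono B z)
      have "c (Suc n) * cmod z ^ (2 * Suc n + 1) \<le> c (Suc n) * cmod z ^ (2 * n + 1)"
        using z c0 by (intro mult_left_mono power_decreasing) auto
      then show "cmod (e (Suc n)) \<le> c (Suc n) * cmod z ^ (2 * n + 1)"
        using err[OF z, of "Suc n"] unfolding e_def by linarith
    qed (use err[OF z] c0 in \<open>auto simp: e_def\<close>)
    finally show ?thesis by (simp add: algebra_simps)
  qed
  have mon: "p = monom (coeff p (2 * n + 1)) (2 * n + 1)"
    by (rule poly_eq_monom_of_order[OF deg bound])
  have prod_coeff: "coeff (f * g) (n + Suc n) = coeff f n * coeff g (Suc n)"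
    if "degree f \<le> n" "degree g \<le> Suc n" for f g :: "complex poly"
  proof -
    have "coeff f i * coeff g (n + Suc n - i) = 0" if "i \<in> {..n + Suc n} - {n}" for i
    proof (cases "i < n")
      case True
      then show ?thesis using \<open>degree g \<le> Suc n\<close> by (simp add: coeff_eq_0)
    next
      case False
      then have "degree f < i" using that \<open>degree f \<le> n\<close> by auto
      then show ?thesis by (simp add: coeff_eq_0)
    qed
    then have "(\<Sum>i\<le>n + Suc n. coeff f i * coeff g (n + Suc n - i)) =
        (\<Sum>i\<in>{n}. coeff f i * coeff g (n + Suc n - i))"
      by (intro sum.mono_neutral_right) auto
    then show ?thesis by (simp add: coeff_mult)
  qed
  define A where "A = ((of_nat n + 1/4 :: complex) gchoose n)"
  define A' where "A' = ((of_nat n + - (1/4) :: complex) gchoose n)"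
  have nz: "A \<noteq> 0" "A' \<noteq> 0"
  proof -
    \<comment> \<open>Neither \<open>n + 1/4\<close> nor \<open>n - 1/4\<close> is an integer, so no
      factor of the two generalised binomials vanishes.\<close>
    have "of_nat n + 1/4 - of_nat i \<noteq> (0::complex)" for i
    proof
      assume "of_nat n + 1/4 - of_nat i = (0::complex)"
      then have "of_real (real n + 1/4 - real i) = (0::complex)" by simp
      then have "real n + 1/4 - real i = 0" by (simp only: of_real_eq_0_iff)
      then have "real (4 * n + 1) = real (4 * i)" by simp
      then have "4 * n + 1 = 4 * i" by (simp only: of_nat_eq_iff)
      then show False by presburger
    qed
    moreover have "of_nat n - 1/4 - of_nat i \<noteq> (0::complex)" for i
    proof
      assume "of_nat n - 1/4 - of_nat i = (0::complex)"
      then have "of_real (real n - 1/4 - real i) = (0::complex)" by simp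
      then have "real n - 1/4 - real i = 0" by (simp only: of_real_eq_0_iff)
      then have "real (4 * n) = real (4 * i + 1)" by simp
      then have "4 * n = 4 * i + 1" by (simp only: of_nat_eq_iff)
      then show False by presburger
    qed
    ultimately show "A \<noteq> 0" "A' \<noteq> 0"
      by (auto simp: A_def A'_def gbinomial_prod_rev)
  qed
  have A1: "((of_nat (Suc n) + 1/4 :: complex) gchoose Suc n) = (of_nat n + 5/4) / of_nat (Suc n) * A"
    using gbinomial_factors[of "of_nat n + 1/4 :: complex" n] by (simp add: A_def add_ac)
  have A2: "((of_nat (Suc n) + - (1/4) :: complex) gchoose Suc n) = (of_nat n + 3/4) / of_nat (Suc n) * A'"
    using gbinomial_factors[of "of_nat n - 1/4 :: complex" n] by (simp add: A'_def algebra_simps)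
  have "coeff p (2 * n + 1) = coeff (T n) n * coeff (S (Suc n)) (Suc n) - coeff (S n) n * coeff (T (Suc n)) (Suc n)"
    using prod_coeff[of "T n" "S (Suc n)"] prod_coeff[of "S n" "T (Suc n)"] degree_pade_poly
    by (simp add: p_def S_def T_def mult_2)
  also have "\<dots> = ((-1) ^ n * (-1) ^ Suc n) *
      (A' * ((of_nat n + 5/4) / of_nat (Suc n) * A) - A * ((of_nat n + 3/4) / of_nat (Suc n) * A'))"
    unfolding S_def T_def coeff_pade_poly A1 A2 A_def[symmetric] A'_def[symmetric]
    by (simp only: right_diff_distrib mult_ac)
  also have "(-1) ^ n * (-1) ^ Suc n = (-1 :: complex)"
    by (simp flip: power_mult_distrib)
  \<comment> \<open>The two products differ only through \<open>5/4 - 3/4 = 1/2\<close>, which keeps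
    the coefficient from vanishing.\<close>
  also have "(-1) * (A' * ((of_nat n + 5/4) / of_nat (Suc n) * A) - A * ((of_nat n + 3/4) / of_nat (Suc n) * A'))
      = - (A * A' / (2 * of_nat (Suc n)))"
    by (simp add: field_simps del: of_nat_Suc)
  finally have "coeff p (2 * n + 1) = - (A * A' / (2 * of_nat (Suc n)))" .
  then have "coeff p (2 * n + 1) \<noteq> 0" 
    using nz by (simp del: of_nat_Suc)
  then have "poly p z \<noteq> 0"
    using assms(2) by (subst mon) (simp add: poly_monom)
  then show ?thesis
    unfolding p_def by (simp add: S T)
qed

subsection \<open>Common factors of the coefficients\<close>

lemma multiplicity_eq_card:
  fixes p m :: nat
  assumes "prime p" "m > 0" "m < p ^ M"
  shows "multiplicity p m = card {e \<in> {1..M}. p ^ e dvd m}"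
proof -
  have p: "1 < p" using assms(1) by (rule prime_gt_1_nat)
  have "p ^ multiplicity p m \<le> m"
    using assms(2) by (intro dvd_imp_le multiplicity_dvd) auto
  then have "p ^ multiplicity p m < p ^ M" using assms(3) by linarith
  then have le: "multiplicity p m \<le> M" using p by (simp add: power_strict_increasing_iff less_imp_le)
  have iff: "p ^ e dvd m \<longleftrightarrow> e \<le> multiplicity p m" for e
    using assms(1,2) p by (intro power_dvd_iff_le_multiplicity) auto
  have "{e \<in> {1..M}. p ^ e dvd m} = {1..multiplicity p m}"
    unfolding iff using le by force
  then show ?thesis by (simp only: card_atLeastAtMost)
qed

lemma multiplicity_prod_eq_sum_card:
  fixes p :: nat and f :: "'a \<Rightarrow> nat"
  assumes "prime p" "finite A" "\<And>i. i \<in> A \<Longrightarrow> f i > 0" "\<And>i. i \<in> A \<Longrightarrow> f i < p ^ M"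
  shows "multiplicity p (\<Prod>i\<in>A. f i) = (\<Sum>e=1..M. card {i \<in> A. p ^ e dvd f i})"
proof -
  have "multiplicity p (\<Prod>i\<in>A. f i) = (\<Sum>i\<in>A. multiplicity p (f i))"
    using assms by (intro prime_elem_multiplicity_prod_distrib) (auto simp: image_iff)
  also have "\<dots> = (\<Sum>i\<in>A. \<Sum>e=1..M. if p ^ e dvd f i then 1 else 0)"
    using assms by (intro sum.cong refl) (simp add: multiplicity_eq_card[of p _ M] sum.If_cases Collect_conj_eq[symmetric] Int_def)
  also have "\<dots> = (\<Sum>e=1..M. \<Sum>i\<in>A. if p ^ e dvd f i then 1 else 0)"
    by (rule sum.swap)
  also have "\<dots> = (\<Sum>e=1..M. card {i \<in> A. p ^ e dvd f i})"
    using assms(2) by (intro sum.cong refl) (simp add: sum.If_cases Int_def)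
  finally show ?thesis .
qed

lemma card_multiples:
  assumes "(q::nat) > 0"
  shows "card {i \<in> {1..n}. q dvd i} = n div q"
proof -
  have "{i \<in> {1..n}. q dvd i} = (\<lambda>j. q * j) ` {1..n div q}"
  proof (intro equalityI subsetI)
    fix i assume "i \<in> {i \<in> {1..n}. q dvd i}"
    then obtain j where j: "i = q * j" "1 \<le> i" "i \<le> n" by auto
    then have "1 \<le> j" by (cases j) auto
    moreover have "j \<le> n div q" using j assms by (simp add: less_eq_div_iff_mult_less_eq mult.commute)
    ultimately show "i \<in> (\<lambda>j. q * j) ` {1..n div q}" using j by auto
  next
    fix i assume "i \<in> (\<lambda>j. q * j) ` {1..n div q}"
    then obtain j where "i = q * j" "j \<in> {1..n div q}" by blast
    then have j: "i = q * j" "1 \<le> j" "j \<le> n div q" by simp_all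
    then have "q * j \<le> n" using assms by (simp add: less_eq_div_iff_mult_less_eq mult.commute)
    then show "i \<in> {i \<in> {1..n}. q dvd i}" using j assms by auto
  qed
  moreover have "inj_on (\<lambda>j. q * j) {1..n div q}" using assms by (auto simp: inj_on_def)
  ultimately show ?thesis by (simp add: card_image)
qed

text \<open>Legendre's formula, cut off at an arbitrary sufficiently large \<open>M\<close> so that
  several factorials can share one range of summation.\<close>

lemma multiplicity_fact:
  fixes p n :: nat
  assumes "prime p" "n < p ^ M"
  shows "multiplicity p (fact n) = (\<Sum>e=1..M. n div p ^ e)"
proof -
  have "multiplicity p (\<Prod>i\<in>{1..n}. i) = (\<Sum>e=1..M. card {i \<in> {1..n}. p ^ e dvd i})"
    using assms by (intro multiplicity_prod_eq_sum_card) auto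
  also have "\<dots> = (\<Sum>e=1..M. n div p ^ e)"
    using prime_gt_0_nat[OF assms(1)] by (intro sum.cong refl card_multiples) simp
  finally show ?thesis by (simp add: fact_prod)
qed

lemma card_multiples_shifted:
  fixes q :: nat
  assumes "q > 0" "m \<le> n"
  shows "card {j \<in> {m<..n}. q dvd j + c} + (m + c) div q = (n + c) div q"
proof -
  have "card {j \<in> {m<..n}. q dvd j + c} = card {i \<in> {m + c<..n + c}. q dvd i}"
  proof (rule bij_betw_same_card)
    show "bij_betw (\<lambda>j. j + c) {j \<in> {m<..n}. q dvd j + c} {i \<in> {m + c<..n + c}. q dvd i}"
      by (rule bij_betw_byWitness[where f' = "\<lambda>i. i - c"]) auto
  qed
  moreover have "card {i \<in> {1..n + c}. q dvd i} =
      card {i \<in> {1..m + c}. q dvd i} + card {i \<in> {m + c<..n + c}. q dvd i}"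
  proof (subst card_Un_disjoint[symmetric])
    show "card {i \<in> {1..n + c}. q dvd i} = card ({i \<in> {1..m + c}. q dvd i} \<union> {i \<in> {m + c<..n + c}. q dvd i})"
      using assms by (intro arg_cong[where f = card]) auto
  qed auto
  ultimately show ?thesis using assms(1) by (simp only: card_multiples)
qed

text \<open>Here \<open>c\<close> is an inverse of 4 modulo \<open>q\<close>, the case depending on
  \<open>q mod 4\<close>. Hence \<open>q\<close> divides \<open>4 * j + 1\<close> exactly when it
  divides \<open>j + c\<close>.\<close>

lemma card_progression:
  fixes q c :: nat
  assumes "odd q" "4 * c = q + 1 \<or> 4 * c = 3 * q + 1" "m \<le> n"
  shows "card {j \<in> {m<..n}. q dvd 4 * j + 1} + (m + c) div q = (n + c) div q"
proof -
  have "q dvd 4 * j + 1 \<longleftrightarrow> q dvd j + c" for j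
  proof -
    have cop: "coprime q 4"
      using assms(1) coprime_power_right_iff[of q 2 2] by simp
    have "4 * (j + c) = (4 * j + 1) + 1 * q \<or> 4 * (j + c) = (4 * j + 1) + 3 * q"
      using assms(2) by auto
    then have "q dvd 4 * (j + c) \<longleftrightarrow> q dvd 4 * j + 1"
      by (elim disjE) (simp_all only: dvd_add_times_triv_right_iff)
    then show ?thesis using coprime_dvd_mult_right_iff[OF cop] by blast
  qed
  moreover have "q > 0" using assms(1) by (cases q) auto
  ultimately show ?thesis using card_multiples_shifted[OF _ assms(3), of q c] by simp
qed

lemma div_eq_add:
  fixes q :: nat
  assumes "x = r + m * q" "q > 0"
  shows "x div q = m + r div q"
  using assms(2) unfolding assms(1) by simp

text \<open>At the level \<open>q = p ^ e\<close> of Legendre's formula, every coefficient of the approximants gains a factor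
  \<open>p\<close> if \<open>n mod q\<close> is at least about \<open>3/4 * q\<close> (\<open>div_binomial_level\<close>). The quotient of factorials
  \<open>(4n/3)! (n/3)! / (n! (2n/3)!)\<close> gains a factor \<open>p\<close> only in that case (\<open>div_thirds_level\<close>).
  Rounding \<open>(4 * n + 1) / 3\<close> instead of \<open>4 * n / 3\<close> keeps its size close to \<open>(4/3) ^ n\<close> also for
  \<open>n mod 3 = 2\<close>.\<close>

lemma div_thirds_level:
  fixes q n :: nat
  assumes "odd q"
  shows "(4 * n + 1) div (3 * q) + n div (3 * q) \<le>
    2 * n div (3 * q) + n div q + (if 4 * (n mod q) + 1 \<ge> 3 * q then 1 else 0)"
proof -
  have q: "q > 0" using assms by (cases q) auto
  define A where "A = n div (3 * q)"
  define r where "r = n mod (3 * q)"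
  define i where "i = r div q"
  define s where "s = r mod q"
  have n: "n = 3 * q * A + r" by (simp add: A_def r_def)
  have r: "r = i * q + s" by (simp add: i_def s_def)
  have s: "s < q" using q by (simp add: s_def)
  have "r < 3 * q" using q by (simp add: r_def)
  then have i: "i < 3" by (simp add: i_def less_mult_imp_div_less)
  have d1: "(4 * n + 1) div (3 * q) = 4 * A + (4 * r + 1) div (3 * q)"
  proof -
    have "4 * n + 1 = (4 * r + 1) + (4 * A) * (3 * q)" unfolding n by (simp add: algebra_simps)
    then show ?thesis using q by (intro div_eq_add) simp_all
  qed
  have d2: "2 * n div (3 * q) = 2 * A + (2 * r) div (3 * q)"
  proof -
    have "2 * n = 2 * r + (2 * A) * (3 * q)" unfolding n by (simp add: algebra_simps)
    then show ?thesis using q by (intro div_eq_add) simp_all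
  qed
  have d3: "n div q = 3 * A + i" "n mod q = s"
  proof -
    have "n = s + (3 * A + i) * q" unfolding n r by (simp add: algebra_simps)
    then show "n div q = 3 * A + i" "n mod q = s" using q s by simp_all
  qed
  have ub: "(4 * r + 1) div (3 * q) \<le> m" if "4 * r + 1 < (m + 1) * (3 * q)" for m
    using less_mult_imp_div_less[OF that] by simp
  have lb: "m \<le> (2 * r) div (3 * q)" if "m * (3 * q) \<le> 2 * r" for m
    using that q by (simp add: less_eq_div_iff_mult_less_eq)
  have "(4 * r + 1) div (3 * q) \<le> (2 * r) div (3 * q) + i + (if 4 * s + 1 \<ge> 3 * q then 1 else 0)"
  proof -
    consider "i = 0" | "i = 1" | "i = 2" using i by linarith
    then show ?thesis
    proof cases
      case 1
      then show ?thesis using ub[of 0] ub[of 1] r s by auto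
    next
      case 2
      \<comment> \<open>As \<open>q\<close> is odd, \<open>2 * s < q\<close> improves to
        \<open>4 * s + 2 \<le> 2 * q\<close>.\<close>
      have "2 * s \<ge> q \<or> 4 * s + 1 < 2 * q" using assms by presburger
      then show ?thesis using ub[of 1] ub[of 2] lb[of 1] r s 2 by auto
    next
      case 3
      then show ?thesis using ub[of 3] lb[of 1] r s by auto
    qed
  qed
  then show ?thesis unfolding d1 d2 d3 A_def[symmetric] by simp
qed

lemma div_binomial_level:
  fixes q c k n :: nat
  assumes "odd q" "4 * c = q + 1 \<or> 4 * c = 3 * q + 1" "k \<le> n"
  shows "k div q + (n - k) div q + n div q + (n - k + c) div q +
      (if 4 * (n mod q) + 1 \<ge> 3 * q then 1 else 0) \<le> (n + c) div q + (2 * n - k) div q"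
proof -
  have q: "q > 0" using assms(1) by (cases q) auto
  define b e x y where "b = k div q" and "e = (n - k) div q" and "x = k mod q" and "y = (n - k) mod q"
  have k: "k = x + b * q" and y': "n - k = y + e * q" by (simp_all add: b_def e_def x_def y_def)
  have xy: "x < q" "y < q" using q by (simp_all add: x_def y_def)
  have n: "n = (x + y) + (b + e) * q" using k y' assms(3) by (simp add: algebra_simps)
  have d1: "n div q = (x + y) div q + (b + e)" "n mod q = (x + y) mod q"
    unfolding n using q by simp_all
  have d2: "(n + c) div q = (x + y + c) div q + (b + e)"
  proof -
    have "n + c = (x + y + c) + (b + e) * q" using n by simp
    then show ?thesis using div_eq_add[OF _ q] by (metis add.commute)
  qed
  have d3: "(n - k + c) div q = (y + c) div q + e"
  proof -
    have "n - k + c = (y + c) + e * q" using y' by simp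
    then show ?thesis using div_eq_add[OF _ q] by (metis add.commute)
  qed
  have d4: "(2 * n - k) div q = (x + 2 * y) div q + (b + 2 * e)"
  proof -
    have "2 * n - k = (x + 2 * y) + (b + 2 * e) * q"
      using n k y' assms(3) by (simp add: algebra_simps)
    then show ?thesis using div_eq_add[OF _ q] by (metis add.commute)
  qed
  have c: "c \<le> q" using assms(2) q by auto
  have lb: "m \<le> z div q" if "m * q \<le> z" for m z
    using that q by (simp add: less_eq_div_iff_mult_less_eq)
  have yc: "(y + c) div q \<le> 1" 
    using xy c less_mult_imp_div_less[of "y + c" 2 q] by auto
  have "(x + y) div q + (y + c) div q + (if 4 * ((x + y) mod q) + 1 \<ge> 3 * q then 1 else 0) \<le>
      (x + y + c) div q + (x + 2 * y) div q"
  \<comment> \<open>Without a carry \<open>n mod q\<close> is \<open>x + y\<close>. With a carry it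
    is \<open>x + y - q\<close>; then \<open>(x + 2 * y) div q\<close> pays for
    \<open>(y + c) div q\<close>, and \<open>(s + c) div q\<close> pays for the extra 1.\<close>
  proof (cases "x + y < q")
    case True
    have m: "(y + c) div q \<le> (x + y + c) div q" by (intro div_le_mono) simp
    show ?thesis
    proof (cases "4 * (x + y) + 1 \<ge> 3 * q")
      case big: True
      have 1: "1 \<le> (x + y + c) div q"
        by (rule lb) (use big assms(2) in auto)
      have 2: "1 \<le> (x + 2 * y) div q" if "y + c \<ge> q"
        by (rule lb) (use that big assms(2) in auto)
      have 3: "(y + c) div q = 0" if "y + c < q" using that by simp
      show ?thesis using True 1 2 3 yc big by (cases "y + c < q") auto
    qed (use True m in auto)
  next
    case False
    define s where "s = x + y - q"
    have s: "x + y = s + q" "s < q" using False xy by (auto simp: s_def)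
    have sm: "(x + y) mod q = s" "(x + y) div q = 1" unfolding s(1) using s(2) q by simp_all
    have 1: "1 \<le> (x + 2 * y) div q" by (rule lb) (use False in auto)
    have 2: "(x + y + c) div q = 1 + (s + c) div q" using s(1) q by (intro div_eq_add) simp_all
    have 3: "1 \<le> (s + c) div q" if "4 * s + 1 \<ge> 3 * q"
      by (rule lb) (use that assms(2) in auto)
    show ?thesis unfolding sm 2 using 1 3 yc by auto
  qed
  then show ?thesis unfolding d1 d2 d3 d4 b_def[symmetric] e_def[symmetric] by linarith
qed

lemma multiplicity_2_fact_double:
  "multiplicity 2 (fact (2 * m) :: nat) = m + multiplicity 2 (fact m :: nat)"
  "multiplicity 2 (fact (2 * m + 1) :: nat) = m + multiplicity 2 (fact m :: nat)"
proof -
  have odd: "multiplicity 2 (fact (2 * m + 1) :: nat) = multiplicity 2 (fact (2 * m) :: nat)" for m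
  proof -
    have "multiplicity 2 (fact (2 * m + 1) :: nat) = multiplicity 2 (2 * m + 1) + multiplicity 2 (fact (2 * m) :: nat)"
      by (simp add: prime_elem_multiplicity_mult_distrib del: mult_Suc)
    moreover have "multiplicity 2 (2 * m + 1) = 0" by (rule not_dvd_imp_multiplicity_0) simp
    ultimately show ?thesis by simp
  qed
  show even: "multiplicity 2 (fact (2 * m) :: nat) = m + multiplicity 2 (fact m :: nat)"
  proof (induction m)
    case (Suc m)
    have "fact (2 * Suc m) = (2 * Suc m) * (fact (2 * m + 1) :: nat)" by simp
    also have "multiplicity 2 \<dots> = multiplicity 2 (2 * Suc m) + multiplicity 2 (fact (2 * m + 1) :: nat)"
      by (rule prime_elem_multiplicity_mult_distrib) auto
    also have "multiplicity 2 (2 * Suc m) = 1 + multiplicity 2 (Suc m)"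
      by (subst prime_elem_multiplicity_mult_distrib) auto
    also have "1 + multiplicity 2 (Suc m) + multiplicity 2 (fact (2 * m + 1) :: nat) =
        Suc m + (multiplicity 2 (Suc m) + multiplicity 2 (fact m :: nat))"
      unfolding odd Suc.IH by simp
    also have "multiplicity 2 (Suc m) + multiplicity 2 (fact m :: nat) = multiplicity 2 (fact (Suc m) :: nat)"
      unfolding fact_Suc by (subst prime_elem_multiplicity_mult_distrib) auto
    finally show ?case .
  qed simp
  show "multiplicity 2 (fact (2 * m + 1) :: nat) = m + multiplicity 2 (fact m :: nat)"
    unfolding odd by (rule even)
qed

lemma multiplicity_2_fact_le: "multiplicity 2 (fact m :: nat) \<le> m"
proof (induction m rule: less_induct)
  case (less m)
  show ?case
  proof (cases "m = 0")
    case False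
    then have IH: "multiplicity 2 (fact (m div 2) :: nat) \<le> m div 2" by (intro less) simp
    show ?thesis
    proof (cases "even m")
      case True
      then show ?thesis using multiplicity_2_fact_double(1)[of "m div 2"] IH by simp
    next
      case False
      then obtain h where "m = 2 * h + 1" by (rule oddE)
      then show ?thesis using multiplicity_2_fact_double(2)[of h] IH by simp
    qed
  qed simp
qed

text \<open>Valuations are compared prime by prime. For odd \<open>p\<close>, Legendre's formula
  reduces the claim at each level \<open>p ^ e\<close> to the sum of
  \<open>div_binomial_level\<close> and \<open>div_thirds_level\<close>. For \<open>p = 2\<close>
  the factors \<open>4 * j + 1\<close> contribute nothing and \<open>2 ^ k\<close> takes their
  place.\<close>

lemma fact_product_dvd:
  fixes n k :: nat
  assumes "k \<le> n"
  shows "fact ((4 * n + 1) div 3) * fact (n div 3) * fact k * fact (n - k) dvd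
    2 ^ k * (\<Prod>j\<in>{n - k<..n}. 4 * j + 1) * fact (2 * n - k) * (fact (2 * n div 3) :: nat)"
    (is "?l dvd ?r")
proof (rule multiplicity_le_imp_dvd)
  define P where "P = (\<Prod>j\<in>{n - k<..n}. 4 * j + 1)"
  have P0: "P \<noteq> 0" by (simp add: P_def)
  show "?l \<noteq> 0" by simp
  fix p :: nat assume p: "prime p"
  have l: "multiplicity p ?l = multiplicity p (fact ((4 * n + 1) div 3) :: nat) + multiplicity p (fact (n div 3) :: nat) +
      multiplicity p (fact k :: nat) + multiplicity p (fact (n - k) :: nat)"
    using p by (simp add: prime_elem_multiplicity_mult_distrib)
  have r: "multiplicity p ?r = k * multiplicity p 2 + multiplicity p P +
      multiplicity p (fact (2 * n - k) :: nat) + multiplicity p (fact (2 * n div 3) :: nat)"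
    unfolding P_def[symmetric] using p P0
    by (simp add: prime_elem_multiplicity_mult_distrib prime_elem_multiplicity_power_distrib)
  show "multiplicity p ?l \<le> multiplicity p ?r"
  proof (cases "p = 2")
    case True
    define h where "h = 2 * n div 3"
    have "(4 * n + 1) div 3 = 2 * h \<or> (4 * n + 1) div 3 = 2 * h + 1"
      unfolding h_def by presburger
    then have 1: "multiplicity 2 (fact ((4 * n + 1) div 3) :: nat) = h + multiplicity 2 (fact h :: nat)"
      using multiplicity_2_fact_double[of h] by auto
    have "h + n div 3 \<le> n" unfolding h_def by presburger
    then have 2: "h + multiplicity 2 (fact (n div 3) :: nat) \<le> n"
      using multiplicity_2_fact_le[of "n div 3"] by linarith
    have "fact (2 * (n - k)) * fact k dvd (fact (2 * n - k) :: nat)"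
    proof -
      have "2 * (n - k) + k = 2 * n - k" using assms by simp
      then show ?thesis using fact_fact_dvd_fact[of "2 * (n - k)" k] by metis
    qed
    then have "multiplicity 2 (fact (2 * (n - k)) * fact k :: nat) \<le> multiplicity 2 (fact (2 * n - k) :: nat)"
      by (intro dvd_imp_multiplicity_le) auto
    then have 3: "n - k + multiplicity 2 (fact (n - k) :: nat) + multiplicity 2 (fact k :: nat) \<le>
        multiplicity 2 (fact (2 * n - k) :: nat)"
      using multiplicity_2_fact_double(1)[of "n - k"] by (simp add: prime_elem_multiplicity_mult_distrib)
    have 4: "k * multiplicity 2 (2::nat) = k" by simp
    have 5: "n - k + k = n" using assms by simp
    show ?thesis unfolding l r unfolding True 4 h_def[symmetric] using 1 2 3 5 by linarith
  next
    case False
    then have "p > 2" using prime_ge_2_nat[OF p] by simp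
    then have "odd p" using p prime_odd_nat by blast
    have p1: "1 < p" using p by (rule prime_gt_1_nat)
    \<comment> \<open>All factorial arguments and all factors \<open>4 * j + 1\<close> are at most
      \<open>4 * n + 1\<close>, hence below \<open>p ^ M\<close>.\<close>
    define M where "M = 4 * n + 2"
    have "M < p ^ M" using p1 by (intro power_gt_expt) simp
    then have M: "m < p ^ M" if "m \<le> 4 * n + 1" for m using that by (simp add: M_def)
    have F: "multiplicity p (fact m :: nat) = (\<Sum>e=1..M. m div p ^ e)" if "m \<le> 4 * n + 1" for m
      by (rule multiplicity_fact[OF p M[OF that]])
    have Pm: "multiplicity p P = (\<Sum>e=1..M. card {j \<in> {n - k<..n}. p ^ e dvd 4 * j + 1})"
      unfolding P_def by (rule multiplicity_prod_eq_sum_card[OF p]) (auto intro!: M)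
    have "(4 * n + 1) div 3 div p ^ e + n div 3 div p ^ e + k div p ^ e + (n - k) div p ^ e \<le>
       card {j \<in> {n - k<..n}. p ^ e dvd 4 * j + 1} + (2 * n - k) div p ^ e + 2 * n div 3 div p ^ e" for e
    proof -
      define q where "q = p ^ e"
      have q: "odd q" using \<open>odd p\<close> by (simp add: q_def)
      have "\<exists>c. 4 * c = q + 1 \<or> 4 * c = 3 * q + 1" using q by presburger
      then obtain c where c: "4 * c = q + 1 \<or> 4 * c = 3 * q + 1" by blast
      have "card {j \<in> {n - k<..n}. q dvd 4 * j + 1} + (n - k + c) div q = (n + c) div q"
        by (rule card_progression[OF q c]) simp
      then show ?thesis
        using div_binomial_level[OF q c assms] div_thirds_level[OF q, of n]
        unfolding q_def[symmetric] div_mult2_eq[symmetric] by linarith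
    qed
    then have "(\<Sum>e=1..M. (4 * n + 1) div 3 div p ^ e + n div 3 div p ^ e + k div p ^ e + (n - k) div p ^ e) \<le>
       (\<Sum>e=1..M. card {j \<in> {n - k<..n}. p ^ e dvd 4 * j + 1} + (2 * n - k) div p ^ e + 2 * n div 3 div p ^ e)"
      by (intro sum_mono)
    then show ?thesis
      unfolding l r Pm using F assms by (simp add: sum.distrib)
  qed
qed

lemma fact_add_numeral:
  "fact (m + 1) = (m + 1) * (fact m :: nat)"
  "fact (m + 2) = (m + 1) * (m + 2) * (fact m :: nat)"
  "fact (m + 3) = (m + 1) * (m + 2) * (m + 3) * (fact m :: nat)"
  "fact (m + 4) = (m + 1) * (m + 2) * (m + 3) * (m + 4) * (fact m :: nat)"
proof -
  have e: "m + 2 = Suc (m + 1)" "m + 3 = Suc (m + 2)" "m + 4 = Suc (m + 3)" by simp_all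
  show 1: "fact (m + 1) = (m + 1) * (fact m :: nat)" by simp
  have "fact (m + 2) = (m + 2) * (fact (m + 1) :: nat)" unfolding e(1) by (simp only: fact_Suc of_nat_id)
  then show 2: "fact (m + 2) = (m + 1) * (m + 2) * (fact m :: nat)" unfolding 1 by (simp only: mult_ac)
  have "fact (m + 3) = (m + 3) * (fact (m + 2) :: nat)" unfolding e(2) by (simp only: fact_Suc of_nat_id)
  then show 3: "fact (m + 3) = (m + 1) * (m + 2) * (m + 3) * (fact m :: nat)" unfolding 2 by (simp only: mult_ac)
  have "fact (m + 4) = (m + 4) * (fact (m + 3) :: nat)" unfolding e(3) by (simp only: fact_Suc of_nat_id)
  then show "fact (m + 4) = (m + 1) * (m + 2) * (m + 3) * (m + 4) * (fact m :: nat)" unfolding 3 by (simp only: mult_ac)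
qed

text \<open>For multiples of 3, raising \<open>n\<close> by 3 multiplies the quotient of the two
  factorial products by a ratio that tends to \<open>64/27\<close> and is at least 2. The other
  residues follow by comparing the few extra factors.\<close>

lemma fact_product_ge:
  "2 ^ (n div 3) * fact n * fact (2 * n div 3) \<le> (fact ((4 * n + 1) div 3) * fact (n div 3) :: nat)"
proof -
  have base: "2 ^ m * fact (3 * m) * fact (2 * m) \<le> (fact (4 * m) * fact m :: nat)" for m
  proof (induction m)
    case (Suc m)
    have e: "3 * Suc m = 3 * m + 3" "2 * Suc m = 2 * m + 2" "4 * Suc m = 4 * m + 4" "Suc m = m + 1"
      by simp_all
    have "2 ^ Suc m * fact (3 * Suc m) * fact (2 * Suc m) =
        (2 * ((3 * m + 1) * (3 * m + 2) * (3 * m + 3)) * ((2 * m + 1) * (2 * m + 2))) *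
        (2 ^ m * fact (3 * m) * fact (2 * m) :: nat)"
      unfolding e(1-2) fact_add_numeral power_Suc by (simp only: mult_ac)
    also have "\<dots> \<le> ((4 * m + 1) * (4 * m + 2) * (4 * m + 3) * (4 * m + 4) * (m + 1)) * (fact (4 * m) * fact m)"
    proof (rule mult_mono[OF _ Suc.IH])
      have "12 * ((3 * m + 1) * (3 * m + 2)) \<le> 8 * ((4 * m + 1) * (4 * m + 3))"
        by (simp add: algebra_simps)
      then have "12 * ((3 * m + 1) * (3 * m + 2)) * ((m + 1) * (m + 1) * (2 * m + 1)) \<le>
          8 * ((4 * m + 1) * (4 * m + 3)) * ((m + 1) * (m + 1) * (2 * m + 1))"
        by (rule mult_right_mono) simp
      then show "2 * ((3 * m + 1) * (3 * m + 2) * (3 * m + 3)) * ((2 * m + 1) * (2 * m + 2)) \<le>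
          (4 * m + 1) * (4 * m + 2) * (4 * m + 3) * (4 * m + 4) * (m + 1)"
        by (simp add: algebra_simps)
    qed auto
    also have "\<dots> = fact (4 * Suc m) * fact (Suc m)"
      unfolding e(3) unfolding e(4) fact_add_numeral by (simp only: mult_ac)
    finally show ?case .
  qed simp
  define m where "m = n div 3"
  consider "n = 3 * m" | "n = 3 * m + 1" | "n = 3 * m + 2"
    unfolding m_def by linarith
  then show ?thesis
  proof cases
    case 1
    then have d: "n div 3 = m" "2 * n div 3 = 2 * m" "(4 * n + 1) div 3 = 4 * m" by simp_all
    show ?thesis using base[of m] unfolding d unfolding 1 .
  next
    case 2
    then have d: "n div 3 = m" "2 * n div 3 = 2 * m" "(4 * n + 1) div 3 = 4 * m + 1" by simp_all
    have "2 ^ m * fact (3 * m + 1) * fact (2 * m) = (3 * m + 1) * (2 ^ m * fact (3 * m) * fact (2 * m) :: nat)"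
      unfolding fact_add_numeral by (simp only: mult_ac)
    also have "\<dots> \<le> (4 * m + 1) * (fact (4 * m) * fact m)"
      by (rule mult_mono[OF _ base]) auto
    also have "\<dots> = fact (4 * m + 1) * fact m"
      unfolding fact_add_numeral by (simp only: mult_ac)
    finally show ?thesis unfolding d unfolding 2 .
  next
    case 3
    then have d: "n div 3 = m" "2 * n div 3 = 2 * m + 1" "(4 * n + 1) div 3 = 4 * m + 3" by simp_all
    have "2 ^ m * fact (3 * m + 2) * fact (2 * m + 1) =
        ((3 * m + 1) * (3 * m + 2) * (2 * m + 1)) * (2 ^ m * fact (3 * m) * fact (2 * m) :: nat)"
      unfolding fact_add_numeral by (simp only: mult_ac)
    also have "\<dots> \<le> ((4 * m + 1) * (4 * m + 2) * (4 * m + 3)) * (fact (4 * m) * fact m)"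
    proof (rule mult_mono[OF _ base])
      show "(3 * m + 1) * (3 * m + 2) * (2 * m + 1) \<le> (4 * m + 1) * (4 * m + 2) * (4 * m + 3)"
        by (intro mult_mono) auto
    qed auto
    also have "\<dots> = fact (4 * m + 3) * fact m"
      unfolding fact_add_numeral by (simp only: mult_ac)
    finally show ?thesis unfolding d unfolding 3 .
  qed
qed

text \<open>A real number because it need not be an integer: for \<open>n = 4\<close> it is
  \<open>5/2\<close>. It serves only as a scale of which all scaled coefficients are integral
  multiples.\<close>

definition pade_content :: "nat \<Rightarrow> real" where
  "pade_content n = fact ((4 * n + 1) div 3) * fact (n div 3) / (fact n * fact (2 * n div 3))"

lemma pade_content_ge: "2 ^ (n div 3) \<le> pade_content n"
proof -
  have "real (2 ^ (n div 3) * fact n * fact (2 * n div 3)) \<le> real (fact ((4 * n + 1) div 3) * fact (n div 3))"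
    using fact_product_ge by (rule of_nat_mono)
  then show ?thesis
    unfolding pade_content_def by (simp add: pos_le_divide_eq mult.assoc)
qed

text \<open>The factor \<open>4 ^ k\<close> clears the quarters in the generalised binomial, and a
  further \<open>2 ^ k\<close> is what \<open>fact_product_dvd\<close> needs at the prime 2.
  Together they are the \<open>8 ^ k\<close> that \<open>u - w = 8\<close> supplies.\<close>

lemma pade_coefficient:
  assumes "k \<le> n"
  shows "\<exists>g::nat. 8 ^ k * (((of_nat n + 1/4) gchoose k) * of_nat ((2 * n - k) choose n)) =
    (of_real (pade_content n) * of_nat g :: complex)"
proof -
  define P where "P = (\<Prod>j\<in>{n - k<..n}. 4 * j + 1)"
  obtain g where g: "2 ^ k * P * fact (2 * n - k) * fact (2 * n div 3) =
      fact ((4 * n + 1) div 3) * fact (n div 3) * fact k * fact (n - k) * g"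
    using fact_product_dvd[OF assms] unfolding P_def by (elim dvdE)
  have "fact k * ((of_nat n + 1/4 :: complex) gchoose k) = (\<Prod>i = 0..<k. of_nat n + 1/4 - of_nat i)"
    by (rule gbinomial_mult_fact)
  also have "4 ^ k * \<dots> = (\<Prod>i = 0..<k. of_nat (4 * (n - i) + 1))"
  proof -
    have "4 ^ k * (\<Prod>i = 0..<k. of_nat n + 1/4 - of_nat i :: complex) =
        (\<Prod>i = 0..<k. 4 * (of_nat n + 1/4 - of_nat i))"
      by (simp only: prod.distrib prod_constant card_atLeastLessThan diff_zero)
    also have "\<dots> = (\<Prod>i = 0..<k. of_nat (4 * (n - i) + 1))"
      using assms by (intro prod.cong refl) (simp add: of_nat_diff algebra_simps)
    finally show ?thesis .
  qed
  also have "(\<Prod>i = 0..<k. of_nat (4 * (n - i) + 1)) = (of_nat P :: complex)"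
    unfolding P_def of_nat_prod
    using assms by (intro prod.reindex_bij_witness[of _ "\<lambda>j. n - j" "\<lambda>i. n - i"]) auto
  finally have 1: "4 ^ k * (fact k * ((of_nat n + 1/4 :: complex) gchoose k)) = of_nat P" .
  have 2: "of_nat ((2 * n - k) choose n) * (fact n * fact (n - k)) = (fact (2 * n - k) :: complex)"
    using binomial_fact[of n "2 * n - k", where 'a = complex] assms by simp
  have "(2 ^ k * of_nat P * fact (2 * n - k) * fact (2 * n div 3) :: complex) =
      fact ((4 * n + 1) div 3) * fact (n div 3) * fact k * fact (n - k) * of_nat g"
    using arg_cong[OF g, of "of_nat :: nat \<Rightarrow> complex"] by simp
  then have "2 ^ k * (4 ^ k * (fact k * ((of_nat n + 1/4 :: complex) gchoose k))) *
      (of_nat ((2 * n - k) choose n) * (fact n * fact (n - k))) * fact (2 * n div 3) =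
      fact ((4 * n + 1) div 3) * fact (n div 3) * fact k * fact (n - k) * of_nat g"
    unfolding 1 2 .
  moreover have "(8 :: complex) ^ k = 2 ^ k * 4 ^ k"
    by (simp flip: power_mult_distrib)
  ultimately have "(8 ^ k * (((of_nat n + 1/4 :: complex) gchoose k) * of_nat ((2 * n - k) choose n)) *
      (fact n * fact (2 * n div 3))) * (fact k * fact (n - k)) =
      (fact ((4 * n + 1) div 3) * fact (n div 3) * of_nat g) * (fact k * fact (n - k))"
    by (simp only: mult_ac)
  then have "8 ^ k * (((of_nat n + 1/4 :: complex) gchoose k) * of_nat ((2 * n - k) choose n)) *
      (fact n * fact (2 * n div 3)) = fact ((4 * n + 1) div 3) * fact (n div 3) * of_nat g"
    by (subst (asm) mult_right_cancel) auto
  then show ?thesis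
    unfolding pade_content_def of_real_divide of_real_mult of_real_fact
    by (intro exI[of _ g]) (subst times_divide_eq_left, rule eq_divide_imp, simp, assumption)
qed

subsection \<open>Linear forms\<close>

text \<open>Formal conjugation \<open>\<i> \<mapsto> -\<i>\<close> over \<open>R\<close>. It is a
  relation and not a map, since \<open>R\<close> may itself contain \<open>\<i>\<close>, and then
  \<open>z\<close> does not determine \<open>a\<close> and \<open>b\<close>.\<close>

definition integral_pair :: "complex set \<Rightarrow> complex \<Rightarrow> complex \<Rightarrow> bool" where
  "integral_pair R z z' \<longleftrightarrow> (\<exists>a\<in>R. \<exists>b\<in>R. z = a + \<i> * b \<and> z' = a - \<i> * b)"

context integral_ring
begin

lemma zero: "0 \<in> R" using diff[OF one one] by simp

lemma uminus: "u \<in> R \<Longrightarrow> - u \<in> R" using diff[OF zero] by simp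

lemma add: "u \<in> R \<Longrightarrow> v \<in> R \<Longrightarrow> u + v \<in> R" using diff[of u "- v"] uminus by simp

lemma of_nat: "of_nat n \<in> R"
  by (induction n) (auto intro: zero one add)

lemma pairI: "a \<in> R \<Longrightarrow> b \<in> R \<Longrightarrow> integral_pair R (a + \<i> * b) (a - \<i> * b)"
  unfolding integral_pair_def by blast

lemma pair_of_nat: "integral_pair R (of_nat n) (of_nat n)"
  using pairI[OF of_nat zero, of n] by simp

lemma pair_add:
  assumes "integral_pair R z z'" "integral_pair R v v'"
  shows "integral_pair R (z + v) (z' + v')"
proof -
  from assms obtain a b c d where R: "a \<in> R" "b \<in> R" "c \<in> R" "d \<in> R"
    and e: "z = a + \<i> * b" "z' = a - \<i> * b" "v = c + \<i> * d" "v' = c - \<i> * d"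
    unfolding integral_pair_def by blast
  have "z + v = (a + c) + \<i> * (b + d)" "z' + v' = (a + c) - \<i> * (b + d)"
    unfolding e by (simp_all add: algebra_simps)
  then show ?thesis
    using pairI[of "a + c" "b + d"] R add by simp
qed

lemma pair_mult:
  assumes "integral_pair R z z'" "integral_pair R v v'"
  shows "integral_pair R (z * v) (z' * v')"
proof -
  from assms obtain a b c d where R: "a \<in> R" "b \<in> R" "c \<in> R" "d \<in> R"
    and e: "z = a + \<i> * b" "z' = a - \<i> * b" "v = c + \<i> * d" "v' = c - \<i> * d"
    unfolding integral_pair_def by blast
  have "z * v = (a * c - b * d) + \<i> * (a * d + b * c)" "z' * v' = (a * c - b * d) - \<i> * (a * d + b * c)"
    unfolding e by (simp_all add: algebra_simps)
  then show ?thesis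
    using pairI[of "a * c - b * d" "a * d + b * c"] R diff add mult by simp
qed

lemma pair_uminus:
  assumes "integral_pair R z z'"
  shows "integral_pair R (- z) (- z')"
proof -
  from assms obtain a b where "a \<in> R" "b \<in> R" "z = a + \<i> * b" "z' = a - \<i> * b"
    unfolding integral_pair_def by blast
  then show ?thesis
    using pairI[of "- a" "- b"] uminus by simp
qed

lemma pair_power: "integral_pair R z z' \<Longrightarrow> integral_pair R (z ^ n) (z' ^ n)"
  by (induction n) (use pair_of_nat[of 1] in \<open>auto intro: pair_mult\<close>)

lemma pair_sum:
  assumes "\<And>i. i \<in> A \<Longrightarrow> integral_pair R (f i) (g i)"
  shows "integral_pair R (\<Sum>i\<in>A. f i) (\<Sum>i\<in>A. g i)"
  using assms
  by (induction A rule: infinite_finite_induct) (use pair_of_nat[of 0] in \<open>auto intro: pair_add\<close>)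

text \<open>Sum and difference of two conjugates are \<open>2 * a\<close> and
  \<open>2 * \<i> * b\<close> with \<open>a\<close>, \<open>b\<close> in \<open>R\<close>; this
  gives the factor 2 in the lower bound for the linear forms.\<close>

lemma cmod_pair_difference_ge:
  assumes "integral_pair R z z'" "e = 1 \<or> e = -1" "e * z' - z \<noteq> 0"
  shows "cmod (e * z' - z) \<ge> 2"
proof -
  from assms(1) obtain a b where R: "a \<in> R" "b \<in> R" and e: "z = a + \<i> * b" "z' = a - \<i> * b"
    unfolding integral_pair_def by blast
  have "e * z' - z = - 2 * \<i> * b \<or> e * z' - z = - 2 * a"
    using assms(2) unfolding e by (auto simp: algebra_simps)
  then show ?thesis
  proof
    assume eq: "e * z' - z = - 2 * \<i> * b"
    then have "b \<noteq> 0" using assms(3) by auto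
    then show ?thesis using cmod_ge_1[OF R(2)] unfolding eq by (simp add: norm_mult)
  next
    assume eq: "e * z' - z = - 2 * a"
    then have "a \<noteq> 0" using assms(3) by auto
    then show ?thesis using cmod_ge_1[OF R(1)] unfolding eq by (simp add: norm_mult)
  qed
qed

end

text \<open>Once the content \<open>c\<close> is taken out, the polynomials \<open>Q\<close> and
  \<open>Q'\<close> have integer coefficients and are evaluated at the conjugates \<open>u\<close>
  and \<open>-w\<close>. So the two terms of the form are conjugate up to the sign
  \<open>(- 1) ^ n\<close>.\<close>

lemma (in integral_ring) pade_linear_form:
  fixes n :: nat and t x y :: complex
  assumes "t \<in> R" "x \<in> R" "y \<in> R"
  defines "u \<equiv> \<i> * t + 4" and "w \<equiv> \<i> * t - 4"
  defines "\<Lambda> \<equiv> pade (1/4) n w u * (x + \<i> * y) - pade (1/4) n u w * (x - \<i> * y)"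
  assumes "\<Lambda> \<noteq> 0"
  shows "cmod \<Lambda> \<ge> 2 * 2 ^ (n div 3)"
proof -
  define c where "c = (of_real (pade_content n) :: complex)"
  have "\<exists>g::nat. k \<le> n \<longrightarrow> 8 ^ k * (((of_nat n + 1/4) gchoose k) * of_nat ((2 * n - k) choose n)) =
    (c * of_nat g :: complex)" for k
    using pade_coefficient[of k n] unfolding c_def by blast
  then obtain g where g: "\<And>k. k \<le> n \<Longrightarrow> 8 ^ k * (((of_nat n + 1/4) gchoose k) * of_nat ((2 * n - k) choose n)) =
    (c * of_nat (g k) :: complex)"
    by metis
  define Q where "Q = (\<Sum>k\<le>n. of_nat (g k) * (- 1) ^ k * u ^ (n - k))"
  define Q' where "Q' = (\<Sum>k\<le>n. of_nat (g k) * (- 1) ^ k * (- w) ^ (n - k))"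
  have "w - u = - 8" "u - w = 8" by (simp_all add: u_def w_def)
  have S: "pade (1/4) n u w = c * Q"
    unfolding pade_def Q_def sum_distrib_left
  proof (intro sum.cong refl)
    fix k assume "k \<in> {..n}"
    then have k: "8 ^ k * (((of_nat n + 1/4) gchoose k) * of_nat ((2 * n - k) choose n)) = (c * of_nat (g k) :: complex)"
      by (intro g) simp
    have "(w - u) ^ k = (- 1) ^ k * 8 ^ k" unfolding \<open>w - u = - 8\<close> by (simp flip: power_mult_distrib)
    then have "((of_nat n + 1/4) gchoose k) * of_nat ((2 * n - k) choose n) * u ^ (n - k) * (w - u) ^ k =
      (8 ^ k * (((of_nat n + 1/4) gchoose k) * of_nat ((2 * n - k) choose n))) * ((- 1) ^ k * u ^ (n - k))"
      by (simp only: mult_ac)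
    then show "((of_nat n + 1/4) gchoose k) * of_nat ((2 * n - k) choose n) * u ^ (n - k) * (w - u) ^ k =
      c * (of_nat (g k) * (- 1) ^ k * u ^ (n - k))"
      unfolding k by (simp only: mult_ac)
  qed
  have T: "pade (1/4) n w u = c * ((- 1) ^ n * Q')"
    unfolding pade_def Q'_def sum_distrib_left
  proof (intro sum.cong refl)
    fix k assume "k \<in> {..n}"
    then have kn: "k \<le> n" by simp
    then have k: "8 ^ k * (((of_nat n + 1/4) gchoose k) * of_nat ((2 * n - k) choose n)) = (c * of_nat (g k) :: complex)"
      by (rule g)
    have "(- 1) ^ n * ((- 1) ^ k * (- w) ^ (n - k)) = ((- 1) ^ n * (- 1) ^ k * (- 1) ^ (n - k)) * w ^ (n - k)"
      by (simp only: power_minus[of w] mult_ac)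
    also have "(- 1) ^ n * (- 1) ^ k * (- 1) ^ (n - k) = (- 1 :: complex) ^ (n + n)"
      using kn by (simp flip: power_add)
    finally have sgn: "(- 1) ^ n * ((- 1) ^ k * (- w) ^ (n - k)) = w ^ (n - k)" by simp
    have "((of_nat n + 1/4) gchoose k) * of_nat ((2 * n - k) choose n) * w ^ (n - k) * (u - w) ^ k =
      (8 ^ k * (((of_nat n + 1/4) gchoose k) * of_nat ((2 * n - k) choose n))) * w ^ (n - k)"
      unfolding \<open>u - w = 8\<close> by (simp only: mult_ac)
    also have "\<dots> = c * of_nat (g k) * ((- 1) ^ n * ((- 1) ^ k * (- w) ^ (n - k)))"
      unfolding k sgn ..
    finally show "((of_nat n + 1/4) gchoose k) * of_nat ((2 * n - k) choose n) * w ^ (n - k) * (u - w) ^ k =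
      c * ((- 1) ^ n * (of_nat (g k) * (- 1) ^ k * (- w) ^ (n - k)))"
      by (simp only: mult_ac)
  qed
  have uw: "integral_pair R u (- w)"
    using pairI[OF of_nat assms(1), of 4] by (simp add: u_def w_def add_ac)
  have "integral_pair R Q Q'"
    unfolding Q_def Q'_def
    by (intro pair_sum pair_mult pair_of_nat pair_power uw) (use pair_uminus[OF pair_of_nat[of 1]] in simp)
  moreover have "integral_pair R (x - \<i> * y) (x + \<i> * y)"
    using pairI[OF assms(2) uminus[OF assms(3)]] by simp
  ultimately have pair: "integral_pair R (Q * (x - \<i> * y)) (Q' * (x + \<i> * y))"
    by (rule pair_mult)
  have eq: "\<Lambda> = c * ((- 1) ^ n * (Q' * (x + \<i> * y)) - Q * (x - \<i> * y))"
    unfolding \<Lambda>_def S T by (simp add: algebra_simps)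
  moreover have "(- 1) ^ n = (1 :: complex) \<or> (- 1) ^ n = (- 1 :: complex)"
    by (cases "even n") auto
  ultimately have ge2: "cmod ((- 1) ^ n * (Q' * (x + \<i> * y)) - Q * (x - \<i> * y)) \<ge> 2"
    using assms(7) by (intro cmod_pair_difference_ge[OF pair]) auto
  have "2 ^ (n div 3) \<le> cmod c"
    using pade_content_ge[of n] unfolding c_def by simp
  then have "2 ^ (n div 3) * 2 \<le> cmod c * cmod ((- 1) ^ n * (Q' * (x + \<i> * y)) - Q * (x - \<i> * y))"
    using ge2 by (intro mult_mono) auto
  then show ?thesis unfolding eq by (simp add: norm_mult mult.commute)
qed

text \<open>The form \<open>\<Lambda>\<close> of index \<open>n\<close> consists of a part proportional to the approximation error and a part
  proportional to the distance of \<open>U / V\<close> from the root. If \<open>\<Lambda> \<noteq> 0\<close> and \<open>cmod V ^ 3\<close> is at least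
  \<open>threshold s n\<close>, the second part uses up at most half of the lower bound for \<open>\<Lambda>\<close>, and the
  first part then forces \<open>cmod V \<ge> lower_size s n\<close>. Here \<open>s\<close> stands for \<open>cmod (\<i> * t + 4) - 8\<close>.\<close>

definition lower_size :: "real \<Rightarrow> nat \<Rightarrow> real" where
  "lower_size s n = 2 ^ (n div 3) * s ^ (n + 1) / (2 * 16 ^ n)"

definition threshold :: "real \<Rightarrow> nat \<Rightarrow> real" where
  "threshold s n = 32/3 * 4 ^ n * (s + 12) ^ (n + 1) / (s\<^sup>2 * 2 ^ (n div 3))"

section \<open>Numerical comparison of thresholds and lower bounds\<close>

lemma lower_size_ge:
  assumes "s \<ge> 88"
  shows "5 ^ n \<le> lower_size s n"
proof -
  have "(5::real) ^ n \<le> (s / 16) ^ n" using assms by (intro power_mono) auto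
  also have "\<dots> \<le> (s / 16) ^ n * (2 ^ (n div 3) * (s / 2))"
  proof -
    have "1 * 1 \<le> 2 ^ (n div 3) * (s / 2)" using assms by (intro mult_mono) auto
    then have "(s / 16) ^ n * 1 \<le> (s / 16) ^ n * (2 ^ (n div 3) * (s / 2))"
      using assms by (intro mult_left_mono) auto
    then show ?thesis by simp
  qed
  also have "\<dots> = lower_size s n"
    unfolding lower_size_def by (simp add: power_divide mult_ac)
  finally show ?thesis .
qed

text \<open>Together with \<open>threshold_mono\<close> this permits passing to index
  \<open>n + 2\<close> when the form of index \<open>n + 1\<close> vanishes.\<close>

lemma lower_size_mono:
  assumes "s \<ge> 88"
  shows "lower_size s n \<le> lower_size s (Suc n)"
proof -
  have "(2::real) ^ (n div 3) \<le> 2 ^ (Suc n div 3)" by (intro power_increasing) auto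
  moreover have "s ^ (n + 1) / (2 * 16 ^ n) \<le> s ^ (Suc n + 1) / (2 * 16 ^ Suc n)"
    using assms by (simp add: field_simps)
  ultimately have "2 ^ (n div 3) * (s ^ (n + 1) / (2 * 16 ^ n)) \<le> 2 ^ (Suc n div 3) * (s ^ (Suc n + 1) / (2 * 16 ^ Suc n))"
    using assms by (intro mult_mono) auto
  then show ?thesis by (simp add: lower_size_def)
qed

lemma threshold_mono:
  assumes "s \<ge> 88"
  shows "threshold s n \<le> threshold s (Suc n)"
proof -
  have "(2::real) ^ (Suc n div 3) \<le> 2 ^ Suc (n div 3)" by (intro power_increasing) auto
  moreover have "(2::real) \<le> 4 * (s + 12)" using assms by simp
  ultimately have "(2::real) ^ (Suc n div 3) \<le> 4 * (s + 12) * 2 ^ (n div 3)"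
    by (metis (no_types, opaque_lifting) mult_right_mono order_trans power_Suc zero_le_numeral zero_le_power)
  then have "(2::real) ^ (Suc n div 3) * (32/3 * 4 ^ n * (s + 12) ^ (n + 1)) \<le>
      4 * (s + 12) * 2 ^ (n div 3) * (32/3 * 4 ^ n * (s + 12) ^ (n + 1))"
    using assms by (intro mult_right_mono) auto
  then have "32/3 * 4 ^ n * (s + 12) ^ (n + 1) / 2 ^ (n div 3) \<le>
      32/3 * 4 ^ Suc n * (s + 12) ^ (Suc n + 1) / 2 ^ (Suc n div 3)"
    by (simp add: field_simps)
  then have "32/3 * 4 ^ n * (s + 12) ^ (n + 1) / 2 ^ (n div 3) / s\<^sup>2 \<le>
      32/3 * 4 ^ Suc n * (s + 12) ^ (Suc n + 1) / 2 ^ (Suc n div 3) / s\<^sup>2"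
    by (rule divide_right_mono) simp
  then show ?thesis by (simp add: threshold_def mult.commute)
qed

text \<open>The bound reached at index \<open>n\<close> must meet the threshold two indices later,
  as one form may vanish. In the worst case \<open>s = 88\<close>, raising \<open>n\<close> by 3
  changes the quotient of the two sides by \<open>16 * (1331/3200) ^ 3 > 1\<close>. The 16 stems
  entirely from the content of the approximants.\<close>

lemma threshold_le_lower_size_cube:
  assumes "s \<ge> 88"
  shows "threshold s (n + 2) \<le> lower_size s n ^ 3"
proof -
  define m i where "m = n div 3" and "i = n mod 3"
  have n: "n = 3 * m + i" and i: "i < 3" by (simp_all add: m_def i_def)
  \<comment> \<open>All powers of 2 coming from the content: the first factor from the cube, the
    second from the threshold.\<close>
  define r :: real where "r = 2 ^ (3 * (n div 3)) * 2 ^ ((n + 2) div 3)"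
  have key: "512/3 * (25/22) ^ 3 \<le> r * 968 * (1331/3200) ^ n"
  proof -
    have "(1::real) \<le> (16 * (1331/3200) ^ 3) ^ m"
      by (intro one_le_power) (simp add: power3_eq_cube)
    also have "\<dots> = 16 ^ m * (1331/3200) ^ (3 * m)"
      by (simp only: power_mult_distrib power_mult)
    finally have m1: "1 \<le> 16 ^ m * (1331/3200 :: real) ^ (3 * m)" .
    have r: "r = 16 ^ m * (if i = 0 then 1 else 2)"
    proof -
      have "(n + 2) div 3 = m + (if i = 0 then 0 else 1)" using i unfolding n by auto
      moreover have "(16::real) ^ m = 2 ^ (3 * m) * 2 ^ m"
        by (simp add: power_mult flip: power_mult_distrib)
      ultimately show ?thesis unfolding r_def m_def[symmetric] by simp
    qed
    have "512/3 * (25/22) ^ 3 \<le> (if i = 0 then 1 else 2) * 968 * (1331/3200 :: real) ^ i"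
      using i by (auto simp: less_Suc_eq numeral_3_eq_3 power3_eq_cube)
    also have "\<dots> = 1 * \<dots>" by simp
    also have "\<dots> \<le> (16 ^ m * (1331/3200 :: real) ^ (3 * m)) * ((if i = 0 then 1 else 2) * 968 * (1331/3200 :: real) ^ i)"
      using m1 by (intro mult_right_mono) auto
    also have "\<dots> = r * 968 * (1331/3200) ^ n"
      unfolding r n power_add by (simp only: mult_ac)
    finally show ?thesis .
  qed
  have s: "s > 0" using assms by simp
  \<comment> \<open>For \<open>s \<ge> 88\<close> the quotient \<open>(s + 12) / s\<close> is at
    most \<open>100/88 = 25/22\<close>.\<close>
  have "512/3 * 4 ^ n * (s + 12) ^ (n + 3) \<le> 512/3 * 4 ^ n * (25/22 * s) ^ (n + 3)"
    using assms by (intro mult_left_mono power_mono) auto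
  also have "\<dots> = (512/3 * (25/22) ^ 3) * ((50/11) ^ n * s ^ (n + 3))"
  proof -
    have "(50/11 :: real) ^ n = 4 ^ n * (25/22) ^ n" by (simp flip: power_mult_distrib)
    then show ?thesis by (simp only: power_mult_distrib power_add mult_ac)
  qed
  also have "\<dots> \<le> (r * 968 * (1331/3200) ^ n) * ((50/11) ^ n * s ^ (n + 3))"
    using s by (intro mult_right_mono key) auto
  also have "\<dots> = r / 8 * s ^ (n + 3) * (7744 * (121/64) ^ n)"
  proof -
    have "(121/64 :: real) ^ n = (1331/3200) ^ n * (50/11) ^ n" by (simp flip: power_mult_distrib)
    then show ?thesis by simp
  qed
  also have "7744 * (121/64) ^ n = 7744 ^ (n + 1) / (4096 :: real) ^ n"
  proof -
    have "(7744 :: real) ^ n = 4096 ^ n * (121/64) ^ n" by (simp flip: power_mult_distrib)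
    then show ?thesis by simp
  qed
  also have "r / 8 * s ^ (n + 3) * (7744 ^ (n + 1) / 4096 ^ n) \<le> r / 8 * s ^ (n + 3) * ((s\<^sup>2) ^ (n + 1) / 4096 ^ n)"
  proof (intro mult_left_mono divide_right_mono power_mono)
    have "88\<^sup>2 \<le> s\<^sup>2" using assms by (intro power_mono) auto
    then show "7744 \<le> s\<^sup>2" by simp
  qed (use s in \<open>auto simp: r_def\<close>)
  also have "\<dots> = r * s ^ (3 * n + 5) / (8 * 4096 ^ n)"
  proof -
    have e: "3 * n + 5 = (n + 3) + 2 * (n + 1)" by simp
    have "s ^ (3 * n + 5) = s ^ (n + 3) * (s\<^sup>2) ^ (n + 1)"
      unfolding e power_add[of s "n + 3"] power_mult ..
    then show ?thesis by simp
  qed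
  finally have main: "512/3 * 4 ^ n * (s + 12) ^ (n + 3) \<le> r * s ^ (3 * n + 5) / (8 * 4096 ^ n)" .
  have "threshold s (n + 2) = 512/3 * 4 ^ n * (s + 12) ^ (n + 3) / (s\<^sup>2 * 2 ^ ((n + 2) div 3))"
  proof -
    have e: "n + 2 + 1 = n + 3" and "32/3 * (4::real) ^ (n + 2) = 512/3 * 4 ^ n" by (simp_all add: power_add)
    then show ?thesis unfolding threshold_def e by (simp only:)
  qed
  also have "\<dots> \<le> (r * s ^ (3 * n + 5) / (8 * 4096 ^ n)) / (s\<^sup>2 * 2 ^ ((n + 2) div 3))"
    by (rule divide_right_mono[OF main]) simp
  also have "\<dots> = 2 ^ (3 * (n div 3)) * s ^ (3 * n + 3) / (8 * 4096 ^ n)"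
  proof -
    have e: "3 * n + 5 = (3 * n + 3) + 2" by simp
    have "s ^ (3 * n + 5) = s ^ (3 * n + 3) * s\<^sup>2" unfolding e power_add[of s _ 2] ..
    then show ?thesis using s unfolding r_def by simp
  qed
  also have "\<dots> = lower_size s n ^ 3"
  proof -
    have "(4096::real) ^ n = (16 ^ n) ^ 3"
      by (subst power_mult[symmetric], subst mult.commute, subst power_mult) simp
    moreover have "(2::real) ^ (3 * (n div 3)) = (2 ^ (n div 3)) ^ 3"
      by (metis mult.commute power_mult)
    moreover have "s ^ (3 * n + 3) = (s ^ (n + 1)) ^ 3"
    proof -
      have e: "3 * n + 3 = (n + 1) * 3" by simp
      show ?thesis unfolding e power_mult ..
    qed
    ultimately show ?thesis
      unfolding lower_size_def by (simp add: power_divide power_mult_distrib)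
  qed
  finally show ?thesis .
qed

subsection \<open>The diagonal form\<close>

lemma four_power_fact_le: "4 ^ n * (fact n)\<^sup>2 \<le> (fact (2 * n + 1) :: real)"
proof (induction n)
  case (Suc n)
  have "4 ^ Suc n * (fact (Suc n))\<^sup>2 = (4 * (real n + 1)\<^sup>2) * (4 ^ n * (fact n)\<^sup>2 :: real)"
    by (simp add: power_mult_distrib power2_eq_square algebra_simps)
  also have "\<dots> \<le> ((2 * real n + 3) * (2 * real n + 2)) * fact (2 * n + 1)"
    by (rule mult_mono[OF _ Suc.IH]) (auto simp: power2_eq_square algebra_simps)
  also have "\<dots> = fact (2 * Suc n + 1)"
    by (simp add: algebra_simps)
  finally show ?case .
qed simp

text \<open>The moduli of \<open>v - r\<close> and \<open>v + r\<close> add up to at least 2, so one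
  of them is at least 1 and the other is bounded by their product. This is applied first to
  \<open>q\<^sup>2\<close> and then to \<open>q\<close>.\<close>

lemma fourth_power_near_root_of_unity:
  assumes "cmod (q ^ 4 - 1) \<le> 1/10"
  obtains j where "j = 1 \<or> j = -1 \<or> j = \<i> \<or> j = -\<i>" "cmod (q - j) \<le> 1/10"
proof -
  have split: "cmod (v - r) \<le> 1/10 \<or> cmod (v + r) \<le> 1/10"
    if "cmod (v\<^sup>2 - r\<^sup>2) \<le> 1/10" "cmod r = 1" for v r :: complex
  proof -
    have prod: "cmod (v - r) * cmod (v + r) \<le> 1/10"
      using that(1) by (simp add: power2_eq_square algebra_simps flip: norm_mult)
    have "2 * cmod r \<le> cmod (v - r) + cmod (v + r)"
      using norm_triangle_ineq4[of "v + r" "v - r"] by (simp add: norm_mult algebra_simps)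
    then have "1 \<le> cmod (v - r) \<or> 1 \<le> cmod (v + r)" using that(2) by linarith
    then show ?thesis
    proof
      assume "1 \<le> cmod (v - r)"
      then have "1 * cmod (v + r) \<le> cmod (v - r) * cmod (v + r)" by (intro mult_right_mono) auto
      then show ?thesis using prod by linarith
    next
      assume "1 \<le> cmod (v + r)"
      then have "cmod (v - r) * 1 \<le> cmod (v - r) * cmod (v + r)" by (intro mult_left_mono) auto
      then show ?thesis using prod by linarith
    qed
  qed
  have "cmod ((q\<^sup>2)\<^sup>2 - 1\<^sup>2) \<le> 1/10" using assms by (simp flip: power_mult)
  then have "cmod (q\<^sup>2 - 1) \<le> 1/10 \<or> cmod (q\<^sup>2 + 1) \<le> 1/10" by (rule split) simp
  then show thesis
  proof
    assume "cmod (q\<^sup>2 - 1) \<le> 1/10"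
    then show thesis using split[of q 1] that[of 1] that[of "-1"] by auto
  next
    assume "cmod (q\<^sup>2 + 1) \<le> 1/10"
    then show thesis using split[of q \<i>] that[of \<i>] that[of "-\<i>"] by auto
  qed
qed

text \<open>The cubic is the cofactor of \<open>U - v\<close> in \<open>U ^ 4 - v ^ 4\<close>. For
  \<open>U\<close> near \<open>v\<close> it is close to \<open>4 * v ^ 3\<close>, so closeness of
  fourth powers passes to \<open>U\<close> and \<open>v\<close> themselves.\<close>

lemma cubic_factor_lower_bound:
  fixes U v :: complex
  assumes "cmod (U - v) \<le> cmod v / 10"
  shows "3 * cmod v ^ 3 \<le> cmod (U ^ 3 + U\<^sup>2 * v + U * v\<^sup>2 + v ^ 3)"
proof -
  define d where "d = U - v"
  have d: "cmod d \<le> cmod v / 10" using assms by (simp add: d_def)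
  define m where "m = cmod v"
  have "U ^ 3 + U\<^sup>2 * v + U * v\<^sup>2 + v ^ 3 = 4 * v ^ 3 + (6 * v\<^sup>2 * d + 4 * v * d\<^sup>2 + d ^ 3)"
    unfolding d_def by (simp add: power2_eq_square power3_eq_cube algebra_simps)
  moreover have "cmod (6 * v\<^sup>2 * d + 4 * v * d\<^sup>2 + d ^ 3) \<le> m ^ 3"
  proof -
    have "cmod (6 * v\<^sup>2 * d + 4 * v * d\<^sup>2 + d ^ 3) \<le> 6 * m\<^sup>2 * cmod d + 4 * m * (cmod d)\<^sup>2 + cmod d ^ 3"
      unfolding m_def by (intro order.trans[OF norm_triangle_ineq] add_mono) (auto simp: norm_mult norm_power)
    also have "\<dots> \<le> 6 * m\<^sup>2 * (m / 10) + 4 * m * (m / 10)\<^sup>2 + (m / 10) ^ 3"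
      using d unfolding m_def by (intro add_mono mult_left_mono power_mono) auto
    also have "\<dots> = 641/1000 * m ^ 3"
      by (simp add: power2_eq_square power3_eq_cube)
    also have "\<dots> \<le> 1 * m ^ 3" by (intro mult_right_mono) (auto simp: m_def)
    finally show ?thesis by simp
  qed
  moreover have "cmod (4 * v ^ 3) = 4 * m ^ 3" by (simp add: norm_mult norm_power m_def)
  ultimately show ?thesis
    using norm_triangle_ineq2[of "4 * v ^ 3" "- (6 * v\<^sup>2 * d + 4 * v * d\<^sup>2 + d ^ 3)"]
    unfolding m_def by (simp only: diff_minus_eq_add norm_minus_cancel)
qed

locale diagonal_form =
  fixes t :: complex
  assumes t: "cmod t \<ge> 100"
begin

definition u where "u = \<i> * t + 4"
definition w where "w = \<i> * t - 4"
text \<open>Chosen because \<open>1 - cmod z = s / cmod u\<close>; it is also a lower bound for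
  \<open>cmod w\<close>.\<close>

definition s where "s = cmod u - 8"
definition z where "z = 8 / u"
definition \<omega> where "\<omega> = (1 - z) powr (1/4)"

lemma cmod_u: "cmod u \<ge> 96"
  using norm_triangle_ineq2[of "\<i> * t" "-4"] t by (simp add: u_def norm_mult)

lemma cmod_w: "cmod w \<ge> 96"
  using norm_triangle_ineq2[of "\<i> * t" "4"] t by (simp add: w_def norm_mult)

lemma u_ne_0: "u \<noteq> 0" and w_ne_0: "w \<noteq> 0"
  using cmod_u cmod_w by auto

lemma s_ge: "s \<ge> 88" using cmod_u by (simp add: s_def)

lemma s_le_w: "s \<le> cmod w"
  using norm_triangle_ineq2[of u 8] by (simp add: s_def u_def w_def)

lemma w_le: "cmod w \<le> cmod u + 8"
  using norm_triangle_ineq4[of u 8] by (simp add: u_def w_def)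

lemma one_minus_z: "1 - z = w / u"
  using u_ne_0 by (simp add: z_def field_simps) (simp add: u_def w_def)

lemma cmod_z: "cmod z = 8 / cmod u" by (simp add: z_def norm_divide)

lemma cmod_z_less: "cmod z < 1" using cmod_u u_ne_0 by (simp add: cmod_z divide_less_eq)

lemma omega_power: "\<omega> ^ 4 = w / u"
proof -
  have "1 - z \<noteq> 0" using u_ne_0 w_ne_0 by (simp add: one_minus_z)
  then have "\<omega> ^ 4 = exp (Ln (1 - z))"
    by (simp add: \<omega>_def powr_def flip: exp_of_nat_mult)
  then show ?thesis using \<open>1 - z \<noteq> 0\<close> by (simp add: one_minus_z)
qed

lemma omega_ne_0: "\<omega> \<noteq> 0"
  using omega_power u_ne_0 w_ne_0 by (metis divide_eq_0_iff power_0_left zero_neq_numeral)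

lemma u_omega_power: "cmod u * cmod \<omega> ^ 4 = cmod w"
  using omega_power u_ne_0 by (simp add: norm_divide flip: norm_power)

lemma pade_uw: "pade a n u w = u ^ n * pade a n 1 (1 - z)"
  and pade_wu: "pade a n w u = u ^ n * pade a n (1 - z) 1"
  using pade_homogeneous[of a n u 1 "1 - z"] pade_homogeneous[of a n u "1 - z" 1] u_ne_0
  by (simp_all add: one_minus_z)

lemma pade_error_uw:
  "\<omega> * pade (1/4) n w u - pade (1/4) n u w = u ^ n * pade_error (1/4) n z"
  unfolding pade_uw pade_wu pade_error_def \<omega>_def by (simp add: algebra_simps)

text \<open>In \<open>norm_pade_error_le\<close> all powers of \<open>cmod u\<close> cancel against
  \<open>u ^ n\<close>, and \<open>8 ^ (2 * n + 1) / (4 * 4 ^ n)\<close> is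
  \<open>2 * 16 ^ n\<close>.\<close>

lemma norm_pade_error_uw:
  "cmod (\<omega> * pade (1/4) n w u - pade (1/4) n u w) \<le> 2 * 16 ^ n / s ^ (n + 1)"
proof -
  define m where "m = cmod u"
  have m: "m > 8" using cmod_u by (simp add: m_def)
  have "(fact n)\<^sup>2 / (4 * fact (2 * n + 1)) \<le> (1 / (4 * 4 ^ n) :: real)"
  proof -
    have "a / (4 * b) \<le> 1 / (4 * c)" if "c * a \<le> b" "b > 0" "c > 0" for a b c :: real
      using that by (simp add: field_simps)
    from this[OF four_power_fact_le] show ?thesis by simp
  qed
  then have "(fact n)\<^sup>2 / (4 * fact (2 * n + 1)) * cmod z ^ (2 * n + 1) / (1 - cmod z) ^ (n + 1) \<le>
     1 / (4 * 4 ^ n) * cmod z ^ (2 * n + 1) / (1 - cmod z) ^ (n + 1)"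
    using cmod_z_less by (intro divide_right_mono mult_right_mono) auto
  then have "cmod (pade_error (1/4) n z) \<le> 1 / (4 * 4 ^ n) * (8 / m) ^ (2 * n + 1) / (1 - 8 / m) ^ (n + 1)"
    using norm_pade_error_le[OF cmod_z_less, of n] unfolding cmod_z m_def by linarith
  then have "m ^ n * cmod (pade_error (1/4) n z) \<le>
      m ^ n * (1 / (4 * 4 ^ n) * (8 / m) ^ (2 * n + 1) / (1 - 8 / m) ^ (n + 1))"
    using m by (intro mult_left_mono) auto
  also have "\<dots> = 2 * 16 ^ n / (m - 8) ^ (n + 1)"
  proof -
    have "1 - 8 / m = (m - 8) / m" using m by (simp add: field_simps)
    moreover have "(8::real) ^ (2 * n + 1) = 8 * (4 ^ n * 16 ^ n)"
      by (simp add: power_mult flip: power_mult_distrib)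
    moreover have "m ^ (2 * n + 1) = m ^ n * m ^ (n + 1)" by (simp add: mult_2 power_add)
    ultimately show ?thesis using m by (simp add: power_divide)
  qed
  finally show ?thesis
    unfolding pade_error_uw by (simp add: norm_mult norm_power m_def s_def)
qed

text \<open>The product is the other approximant plus the error. With
  \<open>a = 4 ^ n * (s + 12) ^ (n + 1)\<close> these are at most \<open>a / (s + 8)\<close> and
  \<open>8 * a / (s * (s + 8))\<close>, which add up to \<open>a / s\<close>.\<close>

lemma norm_pade_wu:
  "cmod \<omega> * cmod (pade (1/4) n w u) \<le> 4 ^ n * (s + 12) ^ (n + 1) / s"
proof -
  have s: "s \<ge> 88" by (rule s_ge)
  have "cmod (pade (1/4) n u w) \<le> real ((2 * n) choose n) * (cmod u + 4) ^ (n + 1) / cmod u"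
    using u_ne_0 by (intro norm_pade_le) (simp_all add: u_def w_def)
  also have "\<dots> \<le> 4 ^ n * (cmod u + 4) ^ (n + 1) / cmod u"
  proof (intro divide_right_mono mult_right_mono)
    have "(2 * n) choose n \<le> 2 ^ (2 * n)" by (rule binomial_le_pow2)
    then have "real ((2 * n) choose n) \<le> real (2 ^ (2 * n))" by (rule of_nat_mono)
    then show "real ((2 * n) choose n) \<le> 4 ^ n" by (simp add: power_mult)
  qed auto
  also have "\<dots> = 4 ^ n * (s + 12) ^ (n + 1) / (s + 8)" by (simp add: s_def add.commute)
  finally have S: "cmod (pade (1/4) n u w) \<le> 4 ^ n * (s + 12) ^ (n + 1) / (s + 8)" .
  have "cmod \<omega> * cmod (pade (1/4) n w u) = cmod (pade (1/4) n u w + (\<omega> * pade (1/4) n w u - pade (1/4) n u w))"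
    by (simp add: norm_mult)
  also have "\<dots> \<le> 4 ^ n * (s + 12) ^ (n + 1) / (s + 8) + 2 * 16 ^ n / s ^ (n + 1)"
    by (rule order.trans[OF norm_triangle_ineq add_mono[OF S norm_pade_error_uw]])
  also have "2 * 16 ^ n / s ^ (n + 1) \<le> 8 * (4 ^ n * (s + 12) ^ (n + 1)) / (s * (s + 8))"
  proof -
    have "2 * 16 ^ n / s ^ (n + 1) = (16 / s) ^ n * (2 / s)" by (simp add: power_divide mult_ac)
    also have "\<dots> \<le> 1 * (8 / s)" using s by (intro mult_mono power_le_one divide_right_mono) auto
    also have "1 * (8 / s) \<le> (4 ^ n * (s + 12) ^ n) * (8 / s)"
    proof -
      have "1 * 1 \<le> (4::real) ^ n * (s + 12) ^ n"
        using s by (intro mult_mono one_le_power) auto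
      then show ?thesis using s by (intro mult_right_mono) auto
    qed
    also have "\<dots> \<le> (4 ^ n * (s + 12) ^ n) * (8 * (s + 12) / (s * (s + 8)))"
    proof (rule mult_left_mono)
      have "8 / s = 8 * (s + 8) / (s * (s + 8))"
        by (rule nonzero_mult_divide_mult_cancel_right[symmetric]) (use s in simp)
      also have "\<dots> \<le> 8 * (s + 12) / (s * (s + 8))" using s by (intro divide_right_mono) auto
      finally show "8 / s \<le> 8 * (s + 12) / (s * (s + 8))" .
    qed (use s in auto)
    also have "\<dots> = 8 * (4 ^ n * (s + 12) ^ (n + 1)) / (s * (s + 8))" by simp
    finally show ?thesis .
  qed
  also have "4 ^ n * (s + 12) ^ (n + 1) / (s + 8) + 8 * (4 ^ n * (s + 12) ^ (n + 1)) / (s * (s + 8)) =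
      4 ^ n * (s + 12) ^ (n + 1) / s"
  proof -
    have "a / (s + 8) + 8 * a / (s * (s + 8)) = a / s" for a :: real
      using s by (simp add: divide_simps) (simp add: algebra_simps)
    then show ?thesis .
  qed
  finally show ?thesis by simp
qed

lemma pade_determinant_uw:
  "pade (1/4) n w u * pade (1/4) (Suc n) u w \<noteq> pade (1/4) n u w * pade (1/4) (Suc n) w u"
proof -
  have "z \<noteq> 0" using u_ne_0 by (simp add: z_def)
  from pade_determinant_ne_0[OF cmod_z_less this, of n] show ?thesis
    unfolding pade_uw pade_wu using u_ne_0 by simp
qed

end

section \<open>Growth of solutions near the principal root\<close>

locale integral_diagonal_form = integral_ring R + diagonal_form t
  for R t +
  assumes t_in_R: "t \<in> R"
begin

lemma lower_size_le_if_linear_form_ne_0: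
  assumes R: "x \<in> R" "y \<in> R"
    and form: "cmod (u * (x + \<i> * y) ^ 4 - w * (x - \<i> * y) ^ 4) \<le> 32"
    and near: "cmod (x + \<i> * y - \<omega> * (x - \<i> * y)) \<le> cmod (\<omega> * (x - \<i> * y)) / 10"
    and ne: "pade (1/4) n w u * (x + \<i> * y) - pade (1/4) n u w * (x - \<i> * y) \<noteq> 0"
    and V: "x - \<i> * y \<noteq> 0" "threshold s n \<le> cmod (x - \<i> * y) ^ 3"
  shows "lower_size s n \<le> cmod (x - \<i> * y)"
proof -
  define U where "U = x + \<i> * y"
  define V where "V = x - \<i> * y"
  define T where "T = pade (1/4) n w u"
  define E where "E = \<omega> * T - pade (1/4) n u w"
  define e where "e = cmod (U - \<omega> * V)"
  define \<rho> :: real where "\<rho> = 2 ^ (n div 3)"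
  have s: "s \<ge> 88" by (rule s_ge)
  have V0: "cmod V > 0" using V(1) by (simp add: V_def)
  have "2 * \<rho> \<le> cmod (T * U - pade (1/4) n u w * V)"
    using pade_linear_form[OF t_in_R R, of n] ne
    unfolding \<rho>_def T_def U_def V_def u_def w_def by blast
  also have "T * U - pade (1/4) n u w * V = T * (U - \<omega> * V) + E * V"
    by (simp add: E_def algebra_simps)
  also have "cmod \<dots> \<le> cmod T * e + cmod E * cmod V"
    by (rule order.trans[OF norm_triangle_ineq]) (simp add: norm_mult e_def)
  finally have main: "2 * \<rho> \<le> cmod T * e + cmod E * cmod V" .
  have "U ^ 4 - (\<omega> * V) ^ 4 = (U - \<omega> * V) * (U ^ 3 + U\<^sup>2 * (\<omega> * V) + U * (\<omega> * V)\<^sup>2 + (\<omega> * V) ^ 3)"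
    by (simp add: power2_eq_square power3_eq_cube power4_eq_xxxx algebra_simps)
  then have ge: "e * (3 * cmod (\<omega> * V) ^ 3) \<le> cmod (U ^ 4 - (\<omega> * V) ^ 4)" 
    unfolding e_def norm_mult
    using cubic_factor_lower_bound[of U "\<omega> * V"] near unfolding U_def V_def
    by (simp add: norm_mult mult_left_mono)
  have "u * (U ^ 4 - (\<omega> * V) ^ 4) = u * U ^ 4 - w * V ^ 4"
    using u_ne_0 by (simp add: power_mult_distrib omega_power algebra_simps)
  then have "cmod u * cmod (U ^ 4 - (\<omega> * V) ^ 4) \<le> 32"
    using form unfolding U_def[symmetric] V_def[symmetric] by (simp flip: norm_mult)
  moreover have "cmod u * (e * (3 * cmod (\<omega> * V) ^ 3)) \<le> cmod u * cmod (U ^ 4 - (\<omega> * V) ^ 4)"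
    by (intro mult_left_mono ge) simp
  ultimately have "cmod u * (e * (3 * cmod (\<omega> * V) ^ 3)) \<le> 32"
    by linarith
  \<comment> \<open>The factor \<open>cmod \<omega>\<close> is included so that four of them combine
    with \<open>cmod u\<close> into \<open>cmod w\<close>.\<close>
  then have "cmod u * (e * (3 * cmod (\<omega> * V) ^ 3)) * (cmod \<omega> * cmod T) \<le> 32 * (4 ^ n * (s + 12) ^ (n + 1) / s)"
    using norm_pade_wu[of n] unfolding T_def by (intro mult_mono) auto
  moreover have "cmod u * (e * (3 * cmod (\<omega> * V) ^ 3)) * (cmod \<omega> * cmod T) = cmod w * (3 * (cmod T * e) * cmod V ^ 3)"
    unfolding u_omega_power[symmetric] norm_mult by (simp add: power_mult_distrib numeral_eq_Suc)
  moreover have "s * (3 * (cmod T * e) * cmod V ^ 3) \<le> cmod w * (3 * (cmod T * e) * cmod V ^ 3)"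
    using s_le_w by (intro mult_right_mono) (auto simp: e_def)
  ultimately have "s * (3 * (cmod T * e) * cmod V ^ 3) \<le> 32 * (4 ^ n * (s + 12) ^ (n + 1) / s)"
    by linarith
  then have "(cmod T * e) * cmod V ^ 3 \<le> 32/3 * (4 ^ n * (s + 12) ^ (n + 1)) / s\<^sup>2"
    using s by (simp add: field_simps power2_eq_square)
  also have "\<dots> = \<rho> * threshold s n"
    by (simp add: threshold_def \<rho>_def)
  also have "\<dots> \<le> \<rho> * cmod V ^ 3"
    using V(2) by (intro mult_left_mono) (auto simp: \<rho>_def V_def)
  finally have "cmod T * e \<le> \<rho>" using V0 by simp
  with main have "\<rho> \<le> cmod E * cmod V" by linarith
  also have "\<dots> \<le> 2 * 16 ^ n / s ^ (n + 1) * cmod V"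
    using norm_pade_error_uw[of n] unfolding E_def T_def by (intro mult_right_mono) auto
  finally have "\<rho> * s ^ (n + 1) \<le> 2 * 16 ^ n * cmod V"
    using s by (simp add: field_simps)
  then show ?thesis
    unfolding lower_size_def V_def[symmetric] \<rho>_def by (simp add: field_simps)
qed

text \<open>For \<open>y\<close> nonzero, \<open>U - V = 2 * \<i> * y\<close> has modulus at least 2
  although \<open>U\<close> is near \<open>\<omega> * V\<close> and \<open>\<omega>\<close> is near
  1. So \<open>V\<close> is large enough to start the induction, which pushes \<open>cmod V\<close>
  above every \<open>lower_size s n\<close>.\<close>

lemma near_principal_root:
  assumes R: "x \<in> R" "y \<in> R"
    and form: "cmod (u * (x + \<i> * y) ^ 4 - w * (x - \<i> * y) ^ 4) \<le> 32"
    and near: "cmod (x + \<i> * y - \<omega> * (x - \<i> * y)) \<le> cmod (\<omega> * (x - \<i> * y)) / 10"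
  shows "y = 0"
proof (rule ccontr)
  assume y: "y \<noteq> 0"
  define U where "U = x + \<i> * y"
  define V where "V = x - \<i> * y"
  define L where "L n = pade (1/4) n w u * U - pade (1/4) n u w * V" for n
  have s: "s \<ge> 88" by (rule s_ge)
  note step' = lower_size_le_if_linear_form_ne_0[OF R form near, folded U_def V_def, folded L_def]
  have UV: "U - V = 2 * \<i> * y" by (simp add: U_def V_def)
  have "cmod y \<ge> 1" using cmod_ge_1[OF R(2) y] .
  then have UV2: "2 \<le> cmod (U - V)" unfolding UV by (simp add: norm_mult)
  have p0: "pade a 0 v v' = 1" for a v v' by (simp add: pade_def)
  \<comment> \<open>Both approximants of index 0 are 1, so this is the error bound for
    \<open>n = 0\<close>.\<close>
  have "cmod (\<omega> - 1) \<le> 2 / s" using norm_pade_error_uw[of 0] by (simp add: p0)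
  also have "\<dots> \<le> 2 / 88" using s by (intro divide_left_mono) auto
  finally have om: "cmod (\<omega> - 1) \<le> 1/44" by simp
  then have om': "cmod \<omega> \<le> 45/44"
    using norm_triangle_ineq2[of \<omega> 1] by simp
  have "U - V = (U - \<omega> * V) + (\<omega> - 1) * V" by (simp add: algebra_simps)
  then have "cmod (U - V) \<le> cmod (U - \<omega> * V) + cmod ((\<omega> - 1) * V)"
    using norm_triangle_ineq by metis
  also have "\<dots> \<le> cmod (\<omega> * V) / 10 + cmod (\<omega> - 1) * cmod V"
    using near unfolding U_def[symmetric] V_def[symmetric] by (intro add_mono) (simp_all only: norm_mult order_refl)
  also have "\<dots> \<le> 45/44 * cmod V / 10 + 1/44 * cmod V"
    unfolding norm_mult using om om' by (intro add_mono divide_right_mono mult_right_mono) auto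
  finally have V15: "15 \<le> cmod V" using UV2 by simp
  then have V0: "V \<noteq> 0" by auto
  have lower: "lower_size s n \<le> cmod V" for n
  proof (induction n)
    case 0
    have "threshold s 0 \<le> cmod V ^ 3"
    proof -
      have "threshold s 0 = 32/3 * (s + 12) / s\<^sup>2" by (simp add: threshold_def)
      also have "\<dots> \<le> 32/3 * (2 * s) / s\<^sup>2" using s by (intro divide_right_mono) auto
      also have "\<dots> = 64/3 / s" using s by (simp add: power2_eq_square)
      also have "\<dots> \<le> 1" using s by simp
      also have "1 \<le> cmod V ^ 3" using V15 by (intro one_le_power) auto
      finally show ?thesis .
    qed
    then show ?case using UV2 V0 by (intro step') (auto simp: L_def p0)
  next
    case (Suc n)
    have "0 \<le> lower_size s n" using s by (simp add: lower_size_def)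
    then have "lower_size s n ^ 3 \<le> cmod V ^ 3" by (intro power_mono Suc)
    then have th2: "threshold s (Suc (Suc n)) \<le> cmod V ^ 3"
      using threshold_le_lower_size_cube[OF s, of n] by simp
    then have th1: "threshold s (Suc n) \<le> cmod V ^ 3"
      using threshold_mono[OF s, of "Suc n"] by linarith
    show ?case
    proof (cases "L (Suc n) = 0")
      case False
      then show ?thesis using th1 V0 by (intro step')
    next
      case True
      \<comment> \<open>Two consecutive vanishing forms with \<open>V\<close> nonzero would make the
        determinant of the approximants vanish.\<close>
      have "L (Suc (Suc n)) \<noteq> 0"
      proof
        assume "L (Suc (Suc n)) = 0"
        then have 2: "pade (1/4) (Suc (Suc n)) w u * U = pade (1/4) (Suc (Suc n)) u w * V" by (simp add: L_def)
        have 1: "pade (1/4) (Suc n) w u * U = pade (1/4) (Suc n) u w * V" using True by (simp add: L_def)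
        have "(pade (1/4) (Suc n) w u * pade (1/4) (Suc (Suc n)) u w) * V =
            pade (1/4) (Suc n) w u * (pade (1/4) (Suc (Suc n)) w u * U)"
          unfolding 2 by (simp only: mult_ac)
        also have "\<dots> = pade (1/4) (Suc (Suc n)) w u * (pade (1/4) (Suc n) w u * U)"
          by (simp only: mult_ac)
        also have "\<dots> = (pade (1/4) (Suc n) u w * pade (1/4) (Suc (Suc n)) w u) * V"
          unfolding 1 by (simp only: mult_ac)
        finally show False using V0 pade_determinant_uw[of "Suc n"] by simp
      qed
      then have "lower_size s (Suc (Suc n)) \<le> cmod V" using th2 V0 by (intro step')
      then show ?thesis using lower_size_mono[OF s, of "Suc n"] by linarith
    qed
  qed
  obtain n where "cmod V < 5 ^ n" using real_arch_pow[of 5 "cmod V"] by auto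
  then show False using lower[of n] lower_size_ge[OF s, of n] by linarith
qed

section \<open>Reduction to the principal root\<close>

lemma zero_if_small:
  assumes "x \<in> R" "cmod x < 1"
  shows "x = 0"
  using cmod_ge_1[OF assms(1)] assms(2) by fastforce

lemma trivial_solutions:
  assumes R: "x \<in> R" "y \<in> R" and F: "cmod (quartic_form t x y) \<le> 1"
  shows "x = 0 \<or> y = 0"
proof -
  define U where "U = x + \<i> * y"
  define V where "V = x - \<i> * y"
  have ii: "\<i> ^ 3 = - \<i>" "\<i> ^ 4 = 1" by (simp_all add: power3_eq_cube power4_eq_xxxx)
  have diag: "8 * quartic_form t x y = u * U ^ 4 - w * V ^ 4"
    unfolding quartic_form_def U_def V_def u_def w_def
    by (simp add: power2_eq_square power3_eq_cube power4_eq_xxxx algebra_simps)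
  have form: "cmod (u * U ^ 4 - w * V ^ 4) \<le> 8"
    using F by (simp add: norm_mult flip: diag)
  \<comment> \<open>The constant 24 covers both uses: the bound 8 for the diagonal form, and
    \<open>4 * cmod x ^ 4 \<le> 1\<close> multiplied by 6 in the case \<open>x = y\<close> or
    \<open>x = - y\<close>.\<close>
  have small: "c < 1" if "m * c ^ 4 \<le> 24" "m \<ge> 96" "c \<ge> 0" for m c :: real
  proof (rule ccontr)
    assume "\<not> c < 1"
    then have "1 \<le> c ^ 4" by (intro one_le_power) simp
    then have "96 * 1 \<le> m * c ^ 4" using that by (intro mult_mono) auto
    then show False using that by linarith
  qed
  have x_eq: "2 * x = U + V" by (simp add: U_def V_def)
  show ?thesis
  proof (cases "U * V = 0")
    case True
    have "cmod U < 1 \<and> V = 0 \<or> cmod V < 1 \<and> U = 0"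
      using True form small[of "cmod u" "cmod U"] small[of "cmod w" "cmod V"] cmod_u cmod_w
      by (auto simp: norm_mult norm_power)
    then have "cmod (2 * x) < 1" unfolding x_eq by auto
    then show ?thesis using zero_if_small[OF R(1)] by (simp add: norm_mult)
  next
    case False
    have "U * V = x * x + y * y" by (simp add: U_def V_def algebra_simps)
    then have "cmod (U * V) \<ge> 1" using False R add mult by (intro cmod_ge_1) auto
    then have "1 \<le> (cmod U * cmod V) ^ 4" by (intro one_le_power) (simp add: norm_mult)
    define a where "a = cmod U ^ 4"
    define p where "p = cmod V ^ 4"
    have ap: "1 \<le> a * p" "0 \<le> a" "0 \<le> p" using \<open>1 \<le> (cmod U * cmod V) ^ 4\<close>
      by (simp_all add: a_def p_def power_mult_distrib)
    have "cmod u * a \<le> 8 + cmod w * p"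
      using norm_triangle_ineq2[of "u * U ^ 4" "w * V ^ 4"] form by (simp add: norm_mult norm_power a_def p_def)
    also have "\<dots> \<le> 8 + (cmod u + 8) * p" using w_le ap by (intro add_left_mono mult_right_mono) auto
    finally have ua: "cmod u * a \<le> 8 + (cmod u + 8) * p" .
    \<comment> \<open>Since \<open>a * p \<ge> 1\<close> and \<open>cmod u * a\<close> is nearly
      bounded by \<open>cmod u * p\<close>, a smaller \<open>p\<close> would force
      \<open>cmod u \<le> 72\<close>.\<close>
    have p9: "9/10 \<le> p"
    proof (rule ccontr)
      assume "\<not> 9/10 \<le> p"
      then have p: "p \<le> 9/10" by simp
      have "cmod u * 1 \<le> cmod u * (a * p)" using ap by (intro mult_left_mono) auto
      also have "\<dots> = (cmod u * a) * p" by simp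
      also have "\<dots> \<le> (8 + (cmod u + 8) * p) * p" using ua ap by (intro mult_right_mono) auto
      also have "\<dots> \<le> (8 + (cmod u + 8) * (9/10)) * (9/10)"
        using p ap by (intro mult_mono add_left_mono mult_left_mono) auto
      finally have "cmod u * 1 \<le> (8 + (cmod u + 8) * (9/10)) * (9/10)" .
      moreover have "m \<le> 72" if "m * 1 \<le> (8 + (m + 8) * (9/10)) * (9/10)" for m :: real
        using that by (simp add: field_simps)
      ultimately show False using cmod_u by fastforce
    qed
    define v where "v = \<omega> * V"
    have v0: "v \<noteq> 0" using False omega_ne_0 by (auto simp: v_def)
    define q where "q = U / v"
    have Uq: "U = q * v" using v0 by (simp add: q_def)
    have uv: "u * v ^ 4 = w * V ^ 4"
      using u_ne_0 by (simp add: v_def power_mult_distrib omega_power)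
    have "w * V ^ 4 * (q ^ 4 - 1) = u * U ^ 4 - w * V ^ 4"
      unfolding uv[symmetric] Uq by (simp add: power_mult_distrib algebra_simps)
    then have "cmod w * p * cmod (q ^ 4 - 1) \<le> 8"
      using form by (metis norm_mult norm_power p_def)
    moreover have "(96 * (9/10)) * cmod (q ^ 4 - 1) \<le> (cmod w * p) * cmod (q ^ 4 - 1)"
      using cmod_w p9 by (intro mult_right_mono mult_mono) auto
    ultimately have "cmod (q ^ 4 - 1) \<le> 1/10" by simp
    then obtain j where j: "j = 1 \<or> j = -1 \<or> j = \<i> \<or> j = -\<i>" "cmod (q - j) \<le> 1/10"
      by (rule fourth_power_near_root_of_unity)
    have near: "cmod (U - j * v) \<le> cmod v / 10"
    proof -
      have "U - j * v = (q - j) * v" unfolding Uq by (simp add: algebra_simps)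
      then show ?thesis using j(2) mult_right_mono[OF j(2), of "cmod v"] by (simp add: norm_mult)
    qed
    txt \<open>\<open>c = 1, -\<i>, 1 - \<i>, 1 + \<i>\<close> correspond to replacing \<open>(x, y)\<close> by \<open>(x, y)\<close>, \<open>(y, -x)\<close>, \<open>(x + y, y - x)\<close>,
      \<open>(x - y, x + y)\<close>. The last two multiply the form by \<open>-4\<close>, which is why \<open>near_principal_root\<close>
      allows for \<open>32\<close> instead of \<open>8\<close>.\<close>
    have rotated: "Y = 0" if "X \<in> R" "Y \<in> R" "X + \<i> * Y = c * U" "X - \<i> * Y = c * j * V" "c ^ 4 = 1 \<or> c ^ 4 = -4" "c \<noteq> 0" for X Y c
    proof (rule near_principal_root[OF that(1,2)])
      have j4: "j ^ 4 = 1" using j(1) by (auto simp: ii)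
      have "u * (c * U) ^ 4 - w * (c * j * V) ^ 4 = c ^ 4 * (u * U ^ 4 - w * V ^ 4)"
        by (simp add: power_mult_distrib j4 algebra_simps)
      moreover have "cmod (c ^ 4) \<le> 4" using that(5) by auto
      ultimately show "cmod (u * (X + \<i> * Y) ^ 4 - w * (X - \<i> * Y) ^ 4) \<le> 32"
        unfolding that(3,4) using mult_mono[of "cmod (c ^ 4)" 4, OF _ form] by (simp add: norm_mult)
      have e1: "c * U - \<omega> * (c * j * V) = c * (U - j * v)" by (simp add: v_def algebra_simps)
      have e2: "cmod (\<omega> * (c * j * V)) = cmod c * cmod v"
        using j(1) by (auto simp: v_def norm_mult)
      show "cmod (X + \<i> * Y - \<omega> * (X - \<i> * Y)) \<le> cmod (\<omega> * (X - \<i> * Y)) / 10"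
        unfolding that(3,4) e1 e2 using mult_left_mono[OF near, of "cmod c"] by (simp add: norm_mult)
    qed
    \<comment> \<open>For \<open>j = \<i>\<close> and \<open>j = -\<i>\<close> the rotated second
      coordinate is \<open>y - x\<close> or \<open>x + y\<close>, so its vanishing only gives
      \<open>x = y\<close> or \<open>x = - y\<close>.\<close>
    have diagonal: "x = 0" if "x = y \<or> x = - y"
    proof -
      have "quartic_form t x y = - 4 * x ^ 4"
        using that unfolding quartic_form_def
        by (auto simp: power2_eq_square power3_eq_cube power4_eq_xxxx algebra_simps)
      then have "96 * cmod x ^ 4 \<le> 24" using F by (simp add: norm_mult norm_power)
      then show ?thesis using small[of 96 "cmod x"] zero_if_small[OF R(1)] by simp
    qed
    from j(1) consider "j = 1" | "j = -1" | "j = \<i>" | "j = -\<i>" by blast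
    then show ?thesis
    proof cases
      case 1
      then have "y = 0" using R by (intro rotated[of x y 1]) (auto simp: U_def V_def)
      then show ?thesis by simp
    next
      case 2
      then have "- x = 0" using R uminus
        by (intro rotated[of y "- x" "- \<i>"]) (auto simp: U_def V_def ii algebra_simps)
      then show ?thesis by simp
    next
      case 3
      have "y - x = 0"
        by (rule rotated[of "x + y" _ "1 - \<i>"])
          (use R 3 in \<open>auto simp: U_def V_def power4_eq_xxxx algebra_simps complex_eq_iff intro: add diff\<close>)
      then show ?thesis using diagonal by simp
    next
      case 4
      have "x + y = 0"
        by (rule rotated[of "x - y" _ "1 + \<i>"])
          (use R 4 in \<open>auto simp: U_def V_def power4_eq_xxxx algebra_simps complex_eq_iff intro: add diff\<close>)
      then show ?thesis using diagonal by (simp add: eq_neg_iff_add_eq_0)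
    qed
  qed
qed

end

theorem theorem2p1:
  fixes d :: nat and t x y :: complex
  assumes "d > 0" and "squarefree d"
    and "t \<in> imag_quad_integers d" and "cmod t \<ge> 100"
    and "x \<in> imag_quad_integers d" and "y \<in> imag_quad_integers d"
    and "cmod (quartic_form t x y) \<le> 1"
  shows "(x, y) = (0, 0) \<or>
    (\<exists>\<xi>\<in>imag_quad_integers d. root_of_unity \<xi> \<and> ((x, y) = (\<xi>, 0) \<or> (x, y) = (0, \<xi>)))"
proof -
  obtain R where "integral_ring R" and R: "x \<in> R" "y \<in> R" "t \<in> R"
    using integral_ring_containing[OF assms(5,6,3)] by blast
  then interpret integral_diagonal_form R t
    using assms(4) by (intro integral_diagonal_form.intro diagonal_form.intro integral_diagonal_form_axioms.intro)
  \<comment> \<open>With one coordinate 0 the form is the fourth power of the other, so this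
    coordinate lies on the unit circle.\<close>
  have unit: "root_of_unity v" if v: "v \<in> imag_quad_integers d" "v \<in> R" "v \<noteq> 0" "cmod v ^ 4 \<le> 1" for v
  proof -
    have "cmod v \<ge> 1" using cmod_ge_1[OF v(2,3)] .
    moreover have "cmod v \<le> 1"
      using v(4) power_le_one_iff[of "cmod v" 4] by simp
    ultimately show ?thesis using root_of_unity_if_cmod_1[OF v(1) _ assms(1)] by simp
  qed
  from trivial_solutions[OF R(1,2) assms(7)] show ?thesis
  proof
    assume x: "x = 0"
    show ?thesis
    proof (cases "y = 0")
      case False
      have "cmod y ^ 4 \<le> 1" using assms(7) x by (simp add: quartic_form_def norm_power)
      then show ?thesis using unit[OF assms(6) R(2) False] x assms(6) by blast
    qed (simp add: x)
  next
    assume y: "y = 0"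
    show ?thesis
    proof (cases "x = 0")
      case False
      have "cmod x ^ 4 \<le> 1" using assms(7) y by (simp add: quartic_form_def norm_power)
      then show ?thesis using unit[OF assms(5) R(1) False] y assms(5) by blast
    qed (simp add: y)
  qed
qed

end
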